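(* (i) For every $d\ge1$ there are constants $C_d,N_d>0$ such that for every centered, isotropic, log-concave density $f:\mathbb{R}^d\to\mathbb{R}_+$ with covariance $\sigma^2I_d$, $\sigma\ge N_d$, and every $1\le i\le d$, $$\left|\sum_{k\in\mathbb{Z}^d}k_if(k)-\int_{\mathbb{R}^d}x_if(x)\,dx\right|=\left|\sum_{k\in\mathbb{Z}^d}k_if(k)\right|\le C_d.$$ (ii) For $d=1$, for any log-concave centered integrable function $f:\mathbb{R}\to\mathbb{R}_+$ (with $\int f>0$), $$\left|\int_{\mathbb{R}}xf(x)\,dx-\sum_{k\in\mathbb{Z}}kf(k)\right|\le(e+1)\sum_{k\in\mathbb{Z}}f(k).$$
   Context: A function $f:\mathbb{R}^d\to\mathbb{R}_+$ is log-concave if $f=e^{-V}$ with $V:\mathbb{R}^d\to\mathbb{R}\cup\{+\infty\}$ convex. It is centered if $\int xf(x)dx=0$. A density ($\int f=1$) is isotropic if its covariance matrix is $\sigma^2I_d$ for some $\sigma>0$. *)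

theory Defs
  imports "HOL-Analysis.Analysis"
begin

(* Convexity of V with values in the reals extended by \<infinity>.  At t = 0 and t = 1 the
   inequality is trivial, since 0 * \<infinity> = 0 in ereal. *)
definition ext_convex :: "('a::real_vector \<Rightarrow> ereal) \<Rightarrow> bool" where
  "ext_convex V \<longleftrightarrow>
     (\<forall>x. V x \<noteq> - \<infinity>) \<and>
     (\<forall>x y. \<forall>t\<in>{0..1}.
        V ((1 - t) *\<^sub>R x + t *\<^sub>R y) \<le> ereal (1 - t) * V x + ereal t * V y)"

(* exp (- v) with the convention exp (- \<infinity>) = 0; only used for v \<noteq> - \<infinity>. *)
definition exp_neg :: "ereal \<Rightarrow> real" where
  "exp_neg v = (if v = \<infinity> then 0 else exp (- real_of_ereal v))"

definition log_concave_fun :: "('a::real_vector \<Rightarrow> real) \<Rightarrow> bool" where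
  "log_concave_fun f \<longleftrightarrow> (\<exists>V. ext_convex V \<and> (\<forall>x. f x = exp_neg (V x)))"

lemma log_concave_fun_nonneg: "log_concave_fun f \<Longrightarrow> 0 \<le> f x"
  by (auto simp: log_concave_fun_def exp_neg_def)

(* Integrals are taken with respect to lebesgue, the completion of lborel: a log-concave
   function need not be Borel measurable on the boundary of its support. *)
definition centered_fun :: "('a::euclidean_space \<Rightarrow> real) \<Rightarrow> bool" where
  "centered_fun f \<longleftrightarrow> has_bochner_integral lebesgue (\<lambda>x. f x *\<^sub>R x) 0"

definition prob_density :: "('a::euclidean_space \<Rightarrow> real) \<Rightarrow> bool" where
  "prob_density f \<longleftrightarrow> (\<forall>x. 0 \<le> f x) \<and> has_bochner_integral lebesgue f 1"

definition mean_vec :: "(real ^ 'n \<Rightarrow> real) \<Rightarrow> real ^ 'n" where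
  "mean_vec f = (LINT x|lebesgue. f x *\<^sub>R x)"

definition covariance_matrix :: "(real ^ 'n \<Rightarrow> real) \<Rightarrow> real ^ 'n ^ 'n" where
  "covariance_matrix f =
     (\<chi> i j. LINT x|lebesgue. (x $ i - mean_vec f $ i) * (x $ j - mean_vec f $ j) * f x)"

(* mat c is c times the identity matrix. *)
definition isotropic_with :: "real \<Rightarrow> (real ^ 'n \<Rightarrow> real) \<Rightarrow> bool" where
  "isotropic_with \<sigma> f \<longleftrightarrow> \<sigma> > 0 \<and> covariance_matrix f = mat (\<sigma>\<^sup>2)"

definition int_lattice :: "(real ^ 'n) set" where
  "int_lattice = {k. \<forall>i. k $ i \<in> \<int>}"

end

theory Submission
  imports Defs
begin

text \<open>
  For a quasi-concave function on the line, the increments over the intervals [k, k + u] with k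
  an integer and 0 \<le> u \<le> 1 have positive and negative parts bounded by the supremum.  Changing the
  coordinates of a shift u in the unit cube one at a time and averaging over u bounds the
  difference between lattice sum and integral of a quasi-concave function by sums of its suprema
  over lines parallel to the axes.  The positive and negative parts of the first moment integrand
  are log-concave, so this applies to them.

  In dimension 1 these suprema are compared with the sum of g through the inequality
  g x \<le> e g 0, and the factor e is lost on one side of the origin only.

  In dimension d, let M = sup f.  Integrating sqrt (f z f x) \<le> f ((z + x) / 2) over x
  gives \<integral> sqrt (M f) \<le> 2^d.  This makes all low powers of ln (M / f) integrable against f, which yields
  f x \<le> C M exp (- c |x| / \<sigma>).  A separation argument then shows that f is comparable to M on a ball
  of radius comparable to \<sigma>, so M = O(\<sigma>^(-d)), and the suprema over lines sum to O(1).
\<close>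

section \<open>Quasi-concave and log-concave functions\<close>

text \<open>The bound in dimension d rests on a count of powers of \<sigma>. The supremum of |x_i| f
  over a line is of order \<sigma> * \<sigma>^(-d), and it decays at scale \<sigma> in the d - 1
  transversal coordinates, so about \<sigma>^(d-1) lines matter. These powers cancel exactly, so
  nothing may be lost in the prefactor \<sigma>^(-d): this is why an upper bound on M is needed, and
  with it an inner ball of radius comparable to \<sigma>. Since the final constant may not depend on
  f, each intermediate constant depends on d alone; they all come from the bound 2^d on the integral
  of sqrt (M f), combined with the first two moments. With these constants \<sigma> \<ge> 1 is large
  enough in every dimension. In dimension 1 no scale is given, and the sum of g plays the part of
  the scale: [0, x] contains more than x integers. The functions need not be Borel, so integrals are
  only moved by affine substitutions of Lebesgue measure; averaging over the unit cube replaces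
  iterated integration.\<close>

definition quasi_concave :: "('a::real_vector \<Rightarrow> real) \<Rightarrow> bool" where
  "quasi_concave h \<longleftrightarrow>
     (\<forall>x y. \<forall>t\<in>{0..1}. min (h x) (h y) \<le> h ((1 - t) *\<^sub>R x + t *\<^sub>R y))"

text \<open>The multiplicative form of log-concavity, free of extended reals and stable under
  products. Since \<open>0 powr 0 = 0\<close>, the inequality is harmless at t = 0 and t = 1 even
  where f vanishes.\<close>

definition powr_concave :: "('a::real_vector \<Rightarrow> real) \<Rightarrow> bool" where
  "powr_concave f \<longleftrightarrow> (\<forall>x. 0 \<le> f x) \<and>
     (\<forall>x y. \<forall>t\<in>{0..1}. f x powr (1 - t) * f y powr t \<le> f ((1 - t) *\<^sub>R x + t *\<^sub>R y))"

lemma powr_concaveD: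
  assumes "powr_concave f" "0 \<le> t" "t \<le> 1"
  shows "f x powr (1 - t) * f y powr t \<le> f ((1 - t) *\<^sub>R x + t *\<^sub>R y)"
  using assms unfolding powr_concave_def by auto

lemma quasi_concaveD:
  assumes "quasi_concave f" "0 \<le> t" "t \<le> 1"
  shows "min (f x) (f y) \<le> f ((1 - t) *\<^sub>R x + t *\<^sub>R y)"
  using assms unfolding quasi_concave_def by auto

lemma powr_concave_nonneg: "powr_concave f \<Longrightarrow> 0 \<le> f x"
  unfolding powr_concave_def by auto

lemma powr_concave_log_concave:
  fixes f :: "'a::real_vector \<Rightarrow> real"
  assumes "log_concave_fun f"
  shows "powr_concave f"
proof -
  obtain V where V: "ext_convex V" and f: "\<And>x. f x = exp_neg (V x)"
    using assms unfolding log_concave_fun_def by auto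
  show ?thesis
    unfolding powr_concave_def
  proof (intro conjI allI ballI)
    show "0 \<le> f x" for x
      using log_concave_fun_nonneg[OF assms] .
    fix x y :: 'a and t :: real
    assume t: "t \<in> {0..1}"
    let ?z = "(1 - t) *\<^sub>R x + t *\<^sub>R y"
    show "f x powr (1 - t) * f y powr t \<le> f ?z"
    proof (cases "V x = \<infinity> \<or> V y = \<infinity>")
      case True
      then have "f x = 0 \<or> f y = 0"
        by (auto simp: f exp_neg_def)
      then show ?thesis
        using log_concave_fun_nonneg[OF assms] by auto
    next
      case False
      obtain a b where a: "V x = ereal a" and b: "V y = ereal b"
        using False V unfolding ext_convex_def by (metis ereal_cases)
      have "V ?z \<le> ereal (1 - t) * V x + ereal t * V y"
        using V t unfolding ext_convex_def by blast
      then have "V ?z \<le> ereal ((1 - t) * a + t * b)"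
        by (simp add: a b)
      moreover have "V ?z \<noteq> - \<infinity>"
        using V unfolding ext_convex_def by blast
      ultimately obtain c where c: "V ?z = ereal c" "c \<le> (1 - t) * a + t * b"
        by (cases "V ?z") auto
      have "f x powr (1 - t) * f y powr t = exp (- ((1 - t) * a + t * b))"
        by (simp add: f a b exp_neg_def powr_def flip: exp_add)
      also have "\<dots> \<le> f ?z"
        using c by (simp add: f exp_neg_def)
      finally show ?thesis .
    qed
  qed
qed

lemma powr_concave_mult:
  fixes f g :: "'a::real_vector \<Rightarrow> real"
  assumes f: "powr_concave f" and g: "powr_concave g"
  shows "powr_concave (\<lambda>x. f x * g x)"
  unfolding powr_concave_def
proof (intro conjI allI ballI)
  show "0 \<le> f x * g x" for x
    using powr_concave_nonneg[OF f] powr_concave_nonneg[OF g] by simp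
  fix x y :: 'a and t :: real
  assume t: "t \<in> {0..1}"
  let ?z = "(1 - t) *\<^sub>R x + t *\<^sub>R y"
  have "(f x * g x) powr (1 - t) * (f y * g y) powr t
      = (f x powr (1 - t) * f y powr t) * (g x powr (1 - t) * g y powr t)"
    using powr_concave_nonneg[OF f] powr_concave_nonneg[OF g]
    by (simp add: powr_mult algebra_simps)
  also have "\<dots> \<le> f ?z * g ?z"
    using t by (intro mult_mono powr_concaveD[OF f] powr_concaveD[OF g])
      (auto simp: powr_concave_nonneg[OF f])
  finally show "(f x * g x) powr (1 - t) * (f y * g y) powr t \<le> f ?z * g ?z" .
qed

text \<open>Weighted AM-GM where both values are positive; otherwise the left side is 0. Multiplied
  with f, this makes each signed part of a first moment integrand log-concave, hence
  quasi-concave.\<close>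

lemma powr_concave_pos_part_linear:
  fixes Y :: "'a::real_vector \<Rightarrow> real"
  assumes "linear Y"
  shows "powr_concave (\<lambda>x. max 0 (Y x :: real))"
  unfolding powr_concave_def
proof (intro conjI allI ballI)
  fix x y :: 'a and t :: real
  assume t: "t \<in> {0..1}"
  have "max 0 (Y x) powr (1 - t) * max 0 (Y y) powr t \<le> max 0 ((1 - t) * Y x + t * Y y)"
  proof (cases "Y x > 0 \<and> Y y > 0")
    case True
    then show ?thesis
      using t Youngs_inequality_0[of "1 - t" t "Y x" "Y y"] by auto
  qed (auto simp: max_def)
  then show "max 0 (Y x) powr (1 - t) * max 0 (Y y) powr t
      \<le> max 0 (Y ((1 - t) *\<^sub>R x + t *\<^sub>R y))"
    by (simp add: linear_add[OF assms] linear_scale[OF assms])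
qed auto

lemma powr_concave_imp_quasi_concave:
  fixes f :: "'a::real_vector \<Rightarrow> real"
  assumes "powr_concave f"
  shows "quasi_concave f"
  unfolding quasi_concave_def
proof (intro allI ballI)
  fix x y :: 'a and t :: real
  assume t: "t \<in> {0..1}"
  let ?m = "min (f x) (f y)"
  have m: "0 \<le> ?m"
    using powr_concave_nonneg[OF assms] by simp
  then have "?m = ?m powr (1 - t) * ?m powr t"
    by (cases "?m = 0") (auto simp flip: powr_add)
  also have "\<dots> \<le> f x powr (1 - t) * f y powr t"
    using t m by (intro mult_mono powr_mono2) auto
  also have "\<dots> \<le> f ((1 - t) *\<^sub>R x + t *\<^sub>R y)"
    using t powr_concaveD[OF assms] by auto
  finally show "?m \<le> f ((1 - t) *\<^sub>R x + t *\<^sub>R y)" .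
qed

section \<open>Restriction to lines and increments over integer steps\<close>

lemma quasi_concave_along_line:
  assumes "quasi_concave h"
  shows "quasi_concave (\<lambda>t. h (p + t *\<^sub>R v))"
  unfolding quasi_concave_def
proof (intro allI ballI)
  fix x y t :: real
  assume t: "t \<in> {0..1}"
  have "p + ((1 - t) *\<^sub>R x + t *\<^sub>R y) *\<^sub>R v
      = (1 - t) *\<^sub>R (p + x *\<^sub>R v) + t *\<^sub>R (p + y *\<^sub>R v)"
    by (simp add: algebra_simps)
  then show "min (h (p + x *\<^sub>R v)) (h (p + y *\<^sub>R v))
      \<le> h (p + ((1 - t) *\<^sub>R x + t *\<^sub>R y) *\<^sub>R v)"
    using t quasi_concaveD[OF assms] by (metis atLeastAtMost_iff)
qed

lemma quasi_concave_between:
  fixes h :: "real \<Rightarrow> real"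
  assumes "quasi_concave h" "x \<le> y" "y \<le> z"
  shows "min (h x) (h z) \<le> h y"
proof (cases "x = z")
  case False
  define t where "t = (y - x) / (z - x)"
  have t: "0 \<le> t" "t \<le> 1"
    using assms False by (auto simp: t_def field_simps)
  have "t * (z - x) = y - x"
    using False assms by (simp add: t_def)
  then have "y = (1 - t) *\<^sub>R x + t *\<^sub>R z"
    by (simp add: algebra_simps)
  then show ?thesis
    using quasi_concaveD[OF assms(1) t] by metis
qed (use assms in auto)

(* Interlacing: for k' < k with h (k + u) > h k one has k' + u \<le> k, so quasi-concavity
   forces h (k' + u) \<le> h k and the increments telescope. *)
lemma sum_increments_le:
  fixes h :: "real \<Rightarrow> real"
  assumes h: "quasi_concave h" and h0: "\<And>x. 0 \<le> h x" and hB: "\<And>x. h x \<le> B"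
    and F: "finite F" "F \<subseteq> \<int>" and u: "0 \<le> u" "u \<le> 1"
  shows "(\<Sum>k\<in>F. max 0 (h (k + u) - h k)) \<le> B"
proof -
  \<comment> \<open>The bound by the last value reached, rather than by \<open>B\<close>, is what
    the induction on the largest element can carry on: that value is at most \<open>h k\<close> for
    the next point k.\<close>
  let ?P = "\<lambda>F. F \<subseteq> \<int> \<longrightarrow> (\<forall>k\<in>F. h k < h (k + u)) \<longrightarrow>
    (\<Sum>k\<in>F. h (k + u) - h k) \<le> (if F = {} then 0 else h (Max F + u))"
  have P: "?P G" if "finite G" for G
    using that
  proof (induction rule: finite_linorder_max_induct)
    case (insert k A)
    show ?case
    proof (intro impI)
      assume sub: "insert k A \<subseteq> \<int>" and inc: "\<forall>k\<in>insert k A. h k < h (k + u)"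
      have "(\<Sum>k\<in>A. h (k + u) - h k) \<le> h k"
      proof (cases "A = {}")
        case False
        define m where "m = Max A"
        have m: "m \<in> A" "m < k"
          using insert False by (auto simp: m_def)
        have "m \<in> \<int>" "k \<in> \<int>"
          using m sub by auto
        then obtain i j where "m = of_int i" "k = of_int j"
          by (auto elim!: Ints_cases)
        with m have "m + 1 \<le> k"
          by auto
        then have "min (h (m + u)) (h (k + u)) \<le> h k"
          using u by (intro quasi_concave_between[OF h]) auto
        then have "h (m + u) \<le> h k"
          using inc by auto
        moreover have "(\<Sum>k\<in>A. h (k + u) - h k) \<le> h (m + u)"
          using insert.IH sub inc False by (auto simp: m_def)
        ultimately show ?thesis by linarith
      qed (use h0 in auto)
      moreover have "Max (insert k A) = k"
        using insert.hyps by (intro Max_eqI) (auto intro: less_imp_le)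
      moreover have "k \<notin> A"
        using insert by auto
      ultimately show "(\<Sum>k\<in>insert k A. h (k + u) - h k)
          \<le> (if insert k A = {} then 0 else h (Max (insert k A) + u))"
        using insert.hyps by simp
    qed
  qed auto
  define G where "G = {k\<in>F. h k < h (k + u)}"
  have "(\<Sum>k\<in>F. max 0 (h (k + u) - h k)) = (\<Sum>k\<in>G. h (k + u) - h k)"
    unfolding G_def sum.inter_filter[OF F(1)] by (intro sum.cong) auto
  also have "\<dots> \<le> (if G = {} then 0 else h (Max G + u))"
  proof -
    have "finite G" "G \<subseteq> \<int>" "\<forall>k\<in>G. h k < h (k + u)"
      using F by (auto simp: G_def)
    then show ?thesis
      using P by blast
  qed
  also have "\<dots> \<le> B"
    using hB order_trans[OF h0 hB] by (cases "G = {}") auto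
  finally show ?thesis .
qed

text \<open>A decrease of h over [k, k + u] is an increase of x -> h (u - x) over [-k, -k + u],
  whose left end is again an integer. The sign s lets both directions share all later
  arguments.\<close>

lemma sum_signed_increments_le:
  fixes h :: "real \<Rightarrow> real"
  assumes h: "quasi_concave h" and h0: "\<And>x. 0 \<le> h x" and hB: "\<And>x. h x \<le> B"
    and F: "finite F" "F \<subseteq> \<int>" and u: "0 \<le> u" "u \<le> 1" and s: "\<bar>s\<bar> = 1"
  shows "(\<Sum>k\<in>F. max 0 (s * (h (k + u) - h k))) \<le> B"
proof (cases "s = 1")
  case True
  then show ?thesis
    using sum_increments_le[OF assms(1-7)] by simp
next
  case False
  then have s: "s = -1"
    using s by auto
  have "quasi_concave (\<lambda>x. h (u + x *\<^sub>R (-1)))"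
    by (rule quasi_concave_along_line[OF h])
  then have "(\<Sum>k\<in>uminus ` F. max 0 (h (u + (k + u) *\<^sub>R (-1)) - h (u + k *\<^sub>R (-1)))) \<le> B"
    using F u h0 hB by (intro sum_increments_le[where h = "\<lambda>x. h (u + x *\<^sub>R (-1))"]) auto
  then show ?thesis
    by (simp add: s sum.reindex add.commute)
qed

section \<open>Lattice sums and integrals\<close>

text \<open>Stated for any Euclidean space, so that one comparison serves both \<open>real\<close>
  and \<open>real ^ 'n\<close>.\<close>

definition basis_lattice :: "'a::euclidean_space set" where
  "basis_lattice = {k. \<forall>b\<in>Basis. k \<bullet> b \<in> \<int>}"

text \<open>Half-open, so that the lattice translates partition the space and each x lies in the
  translate with corner \<open>floor_vec x\<close>.\<close>

definition unit_cube :: "'a::euclidean_space set" where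
  "unit_cube = {x. \<forall>b\<in>Basis. 0 \<le> x \<bullet> b \<and> x \<bullet> b < 1}"

definition floor_vec :: "'a::euclidean_space \<Rightarrow> 'a" where
  "floor_vec x = (\<Sum>b\<in>Basis. of_int \<lfloor>x \<bullet> b\<rfloor> *\<^sub>R b)"

lemma inner_floor_vec: "b \<in> Basis \<Longrightarrow> floor_vec x \<bullet> b = of_int \<lfloor>x \<bullet> b\<rfloor>"
  unfolding floor_vec_def by simp

lemma floor_vec_in_lattice: "floor_vec x \<in> basis_lattice"
  by (simp add: basis_lattice_def inner_floor_vec)

lemma diff_in_unit_cube_iff:
  assumes "k \<in> basis_lattice"
  shows "x - k \<in> unit_cube \<longleftrightarrow> floor_vec x = k"
proof -
  have "x - k \<in> unit_cube \<longleftrightarrow> (\<forall>b\<in>Basis. of_int \<lfloor>x \<bullet> b\<rfloor> = k \<bullet> b)"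
    unfolding unit_cube_def mem_Collect_eq
  proof (intro ball_cong refl)
    fix b :: 'a
    assume "b \<in> Basis"
    then obtain i where "k \<bullet> b = of_int i"
      using assms by (auto simp: basis_lattice_def elim!: Ints_cases)
    then show "(0 \<le> (x - k) \<bullet> b \<and> (x - k) \<bullet> b < 1) = (of_int \<lfloor>x \<bullet> b\<rfloor> = k \<bullet> b)"
      by (simp add: inner_diff_left floor_eq_iff) linarith
  qed
  also have "\<dots> \<longleftrightarrow> floor_vec x = k"
    by (subst euclidean_eq_iff) (auto simp: inner_floor_vec)
  finally show ?thesis .
qed

lemma sets_unit_cube [measurable]: "unit_cube \<in> sets (borel :: 'a::euclidean_space measure)"
  unfolding unit_cube_def by measurable

lemma unit_cube_subset_cbox: "unit_cube \<subseteq> cbox 0 (One :: 'a::euclidean_space)"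
  unfolding unit_cube_def by (auto simp: mem_box less_imp_le)

lemma emeasure_unit_cube: "emeasure lborel (unit_cube :: 'a::euclidean_space set) = 1"
proof (rule antisym)
  have "emeasure lborel (unit_cube :: 'a set) \<le> emeasure lborel (cbox 0 (One :: 'a))"
    by (intro emeasure_mono unit_cube_subset_cbox) auto
  then show "emeasure lborel (unit_cube :: 'a set) \<le> 1"
    by (simp add: emeasure_lborel_cbox_eq)
  have "emeasure lborel (box 0 (One :: 'a)) \<le> emeasure lborel (unit_cube :: 'a set)"
    by (intro emeasure_mono) (auto simp: unit_cube_def box_def less_imp_le)
  then show "1 \<le> emeasure lborel (unit_cube :: 'a set)"
    by (simp add: emeasure_lborel_box_eq)
qed

lemma has_bochner_integral_unit_cube:
  "has_bochner_integral lebesgue (\<lambda>x. indicator unit_cube (x :: 'a::euclidean_space) * (c :: real)) c"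
proof -
  have "has_bochner_integral lebesgue (indicator (unit_cube :: 'a set) :: 'a \<Rightarrow> real)
      (measure lebesgue (unit_cube :: 'a set))"
    by (intro has_bochner_integral_real_indicator) (simp_all add: emeasure_unit_cube)
  then show ?thesis
    using has_bochner_integral_mult_left[of c lebesgue "indicator (unit_cube :: 'a set)" 1]
    by (simp add: measure_def emeasure_unit_cube)
qed

text \<open>The substitution is made for \<open>lebesgue\<close> itself, since h need not be Borel.
  It is used for translations (m = 1), reflections (m = -1), midpoints (m = 1/2) and contractions
  towards a point (m = 1 - l).\<close>

lemma
  fixes h :: "'a::euclidean_space \<Rightarrow> real"
  assumes h: "integrable lebesgue h" and m: "m \<noteq> 0"
  shows integrable_lebesgue_affine: "integrable lebesgue (\<lambda>x. h (c + m *\<^sub>R x))"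
    and integral_lebesgue_affine:
      "(LINT x|lebesgue. h (c + m *\<^sub>R x)) = (LINT x|lebesgue. h x) / \<bar>m\<bar> ^ DIM('a)"
proof -
  define T :: "'a \<Rightarrow> 'a" where "T = (\<lambda>x. c + m *\<^sub>R x)"
  have T_eq: "(\<lambda>x. c + (\<Sum>j\<in>Basis. (m * (x \<bullet> j)) *\<^sub>R j)) = T"
    unfolding T_def scaleR_scaleR[symmetric] scaleR_sum_right[symmetric] euclidean_representation ..
  have T [measurable]: "T \<in> lebesgue \<rightarrow>\<^sub>M lebesgue"
    using lebesgue_affine_measurable[of "\<lambda>_. m" c] m by (simp add: T_eq)
  have L: "lebesgue = density (distr lebesgue lebesgue T) (\<lambda>_. ennreal (\<bar>m\<bar> ^ DIM('a)))"
    using lebesgue_affine_euclidean[of "\<lambda>_. m" c] m by (simp add: T_eq)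
  have hm [measurable]: "h \<in> borel_measurable lebesgue"
    using h by auto
  have "integrable (density (distr lebesgue lebesgue T) (\<lambda>_. ennreal (\<bar>m\<bar> ^ DIM('a)))) h"
    using h L by simp
  then have "integrable (distr lebesgue lebesgue T) (\<lambda>x. \<bar>m\<bar> ^ DIM('a) *\<^sub>R h x)"
    by (subst (asm) integrable_density) auto
  then have "integrable lebesgue (\<lambda>x. \<bar>m\<bar> ^ DIM('a) *\<^sub>R h (T x))"
    by (subst (asm) integrable_distr_eq) auto
  then show "integrable lebesgue (\<lambda>x. h (c + m *\<^sub>R x))"
    using m by (simp add: T_def)
  have "(LINT x|lebesgue. h x)
      = (LINT x|density (distr lebesgue lebesgue T) (\<lambda>_. ennreal (\<bar>m\<bar> ^ DIM('a))). h x)"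
    using L by simp
  also have "\<dots> = (LINT x|distr lebesgue lebesgue T. \<bar>m\<bar> ^ DIM('a) *\<^sub>R h x)"
    by (subst integral_density) auto
  also have "\<dots> = (LINT x|lebesgue. \<bar>m\<bar> ^ DIM('a) *\<^sub>R h (T x))"
    by (subst integral_distr) auto
  finally show "(LINT x|lebesgue. h (c + m *\<^sub>R x)) = (LINT x|lebesgue. h x) / \<bar>m\<bar> ^ DIM('a)"
    using m by (simp add: T_def)
qed

text \<open>The points of F are grouped into fibres parallel to b, represented by their projections
  to the hyperplane orthogonal to b. On each fibre the one-dimensional bound costs one supremum over
  that line.\<close>

lemma lattice_sum_increments_direction:
  fixes h :: "'a::euclidean_space \<Rightarrow> real"
  assumes h: "quasi_concave h" and h0: "\<And>x. 0 \<le> h x" and b: "b \<in> Basis"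
    and hH: "\<And>x t. h (x + t *\<^sub>R b) \<le> H x"
    and F: "finite F" "F \<subseteq> basis_lattice" and a: "0 \<le> a" "a \<le> 1" and s: "\<bar>s\<bar> = 1"
  shows "(\<Sum>k\<in>F. max 0 (s * (h (k + v + a *\<^sub>R b) - h (k + v))))
    \<le> (\<Sum>k\<in>(\<lambda>k. k - (k \<bullet> b) *\<^sub>R b) ` F. H (k + v))"
proof -
  let ?p = "\<lambda>k. k - (k \<bullet> b) *\<^sub>R b"
  let ?d = "\<lambda>k. max 0 (s * (h (k + v + a *\<^sub>R b) - h (k + v)))"
  have "(\<Sum>k\<in>{k \<in> F. ?p k = y}. ?d k) \<le> H (y + v)" for y
  proof -
    let ?G = "{k \<in> F. ?p k = y}"
    let ?g = "\<lambda>t. h (y + v + t *\<^sub>R b)"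
    have k: "k = y + (k \<bullet> b) *\<^sub>R b" if "k \<in> ?G" for k
      using that by (auto simp: algebra_simps)
    have inj: "inj_on (\<lambda>k. k \<bullet> b) ?G"
      by (rule inj_onI) (metis k)
    have "(\<Sum>k\<in>?G. ?d k) = (\<Sum>k\<in>?G. max 0 (s * (?g (k \<bullet> b + a) - ?g (k \<bullet> b))))"
    proof (intro sum.cong refl)
      fix k
      assume "k \<in> ?G"
      then have "k + v = y + v + (k \<bullet> b) *\<^sub>R b" "k + v + a *\<^sub>R b = y + v + (k \<bullet> b + a) *\<^sub>R b"
        by (auto simp: scaleR_add_left)
      then show "?d k = max 0 (s * (?g (k \<bullet> b + a) - ?g (k \<bullet> b)))"
        by (simp only:)
    qed
    also have "\<dots> = (\<Sum>m\<in>(\<lambda>k. k \<bullet> b) ` ?G. max 0 (s * (?g (m + a) - ?g m)))"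
      by (simp add: sum.reindex[OF inj])
    also have "\<dots> \<le> H (y + v)"
      using F b by (intro sum_signed_increments_le quasi_concave_along_line h h0 hH a s)
        (auto simp: basis_lattice_def)
    finally show ?thesis .
  qed
  then show ?thesis
    by (subst sum.image_gen[OF F(1), of _ ?p]) (intro sum_mono)
qed

lemma finite_lattice_box:
  "finite {k. (k :: 'a::euclidean_space) \<in> basis_lattice \<and> (\<forall>b\<in>Basis. \<bar>k \<bullet> b\<bar> \<le> real n)}" (is "finite ?A")
proof -
  let ?J = "(of_int :: int \<Rightarrow> real) ` {- int n..int n}"
  have "?A \<subseteq> (\<lambda>c. \<Sum>b\<in>Basis. c b *\<^sub>R b) ` (Pi\<^sub>E Basis (\<lambda>_. ?J))"
  proof
    fix k :: 'a
    assume k: "k \<in> ?A"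
    have "k = (\<Sum>b\<in>Basis. restrict (\<lambda>b. k \<bullet> b) Basis b *\<^sub>R b)"
      by (simp add: euclidean_representation)
    moreover have "restrict (\<lambda>b. k \<bullet> b) Basis \<in> Pi\<^sub>E Basis (\<lambda>_. ?J)"
    proof (rule restrict_PiE_iff[THEN iffD2], rule ballI)
      fix b :: 'a
      assume b: "b \<in> Basis"
      then obtain i where "k \<bullet> b = of_int i"
        using k by (auto simp: basis_lattice_def elim!: Ints_cases)
      moreover have "\<bar>k \<bullet> b\<bar> \<le> real n"
        using k b by auto
      ultimately show "k \<bullet> b \<in> ?J"
        by (intro image_eqI[of _ _ i]; simp; linarith)
    qed
    ultimately show "k \<in> (\<lambda>c. \<Sum>b\<in>Basis. c b *\<^sub>R b) ` (Pi\<^sub>E Basis (\<lambda>_. ?J))"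
      by blast
  qed
  then show ?thesis
    by (rule finite_subset) (intro finite_imageI finite_PiE; simp)
qed

text \<open>\<open>H b x\<close> bounds h on the line through x parallel to b, and
  \<open>S b\<close> bounds the sum of these over lattice lines in that direction. The displacement
  v is there because, when coordinate b of the shift is changed, the coordinates changed before have
  already moved the lines off the lattice.\<close>

locale lattice_comparison =
  fixes h :: "'a::euclidean_space \<Rightarrow> real" and H :: "'a \<Rightarrow> 'a \<Rightarrow> real" and S :: "'a \<Rightarrow> real"
  assumes quasi_concave: "quasi_concave h"
    and nonneg: "0 \<le> h x"
    and integrable: "integrable lebesgue h"
    and line_bound: "b \<in> Basis \<Longrightarrow> h (x + t *\<^sub>R b) \<le> H b x"
    and sum_line_bound: "\<lbrakk>b \<in> Basis; finite F; F \<subseteq> basis_lattice; \<And>k. k \<in> F \<Longrightarrow> k \<bullet> b = 0;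
          v \<in> cbox 0 One\<rbrakk> \<Longrightarrow> (\<Sum>k\<in>F. H b (k + v)) \<le> S b"
begin

(* Change one coordinate of the shift u at a time. *)
lemma sum_increments_partial_shift:
  assumes F: "finite F" "F \<subseteq> basis_lattice" and u: "u \<in> cbox 0 One" and s: "\<bar>s\<bar> = 1"
    and T: "finite T" "T \<subseteq> Basis"
  shows "(\<Sum>k\<in>F. max 0 (s * (h (k + (\<Sum>b\<in>T. (u \<bullet> b) *\<^sub>R b)) - h k))) \<le> (\<Sum>b\<in>T. S b)"
  using T
proof (induction rule: finite_induct)
  case (insert b T)
  let ?v = "\<Sum>b\<in>T. (u \<bullet> b) *\<^sub>R b"
  let ?p = "\<lambda>k. k - (k \<bullet> b) *\<^sub>R b"
  have b: "b \<in> Basis" "T \<subseteq> Basis"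
    using insert by auto
  have ub: "0 \<le> u \<bullet> b" "u \<bullet> b \<le> 1"
    using u b by (auto simp: mem_box)
  have v: "?v \<in> cbox 0 One"
    unfolding mem_box
  proof
    fix c :: 'a
    assume c: "c \<in> Basis"
    have "?v \<bullet> c = (\<Sum>b\<in>T. if b = c then u \<bullet> c else 0)"
      unfolding inner_sum_left using b c by (intro sum.cong) (auto simp: inner_Basis)
    then show "0 \<bullet> c \<le> ?v \<bullet> c \<and> ?v \<bullet> c \<le> One \<bullet> c"
      using u c insert.hyps by (auto simp: mem_box)
  qed
  have "(\<Sum>k\<in>F. max 0 (s * (h (k + ?v + (u \<bullet> b) *\<^sub>R b) - h (k + ?v))))
      \<le> (\<Sum>k\<in>?p ` F. H b (k + ?v))"
    using b ub by (intro lattice_sum_increments_direction quasi_concave nonneg line_bound F s)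
  also have "\<dots> \<le> S b"
    using b v F by (intro sum_line_bound) (auto simp: basis_lattice_def inner_diff_left inner_Basis)
  finally have 1: "(\<Sum>k\<in>F. max 0 (s * (h (k + ?v + (u \<bullet> b) *\<^sub>R b) - h (k + ?v)))) \<le> S b" .
  have "(\<Sum>k\<in>F. max 0 (s * (h (k + (\<Sum>b\<in>insert b T. (u \<bullet> b) *\<^sub>R b)) - h k)))
     \<le> (\<Sum>k\<in>F. max 0 (s * (h (k + ?v) - h k))
                + max 0 (s * (h (k + ?v + (u \<bullet> b) *\<^sub>R b) - h (k + ?v))))"
    using insert.hyps by (intro sum_mono) (auto simp: algebra_simps max_def)
  then show ?case
    using 1 insert.IH[OF b(2)] insert.hyps by (simp add: sum.distrib)
qed simp

lemma sum_increments_shift: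
  assumes "finite F" "F \<subseteq> basis_lattice" "u \<in> cbox 0 One" "\<bar>s\<bar> = 1"
  shows "(\<Sum>k\<in>F. s * (h (k + u) - h k)) \<le> (\<Sum>b\<in>Basis. S b)"
proof -
  have "(\<Sum>k\<in>F. s * (h (k + u) - h k)) \<le> (\<Sum>k\<in>F. max 0 (s * (h (k + u) - h k)))"
    by (intro sum_mono) auto
  then show ?thesis
    using sum_increments_partial_shift[OF assms finite_Basis] by (simp add: euclidean_representation)
qed

lemma integrable_on_cube: "integrable lebesgue (\<lambda>x. indicator unit_cube (x - k) * h x)"
proof (rule Bochner_Integration.integrable_bound[OF integrable])
  have "(\<lambda>x. indicator unit_cube (x - k) :: real) \<in> borel_measurable lebesgue"
    by (rule measurable_completion, unfold measurable_lborel2) measurable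
  then show "(\<lambda>x. indicator unit_cube (x - k) * h x) \<in> borel_measurable lebesgue"
    using integrable by (intro borel_measurable_times) auto
qed (auto simp: nonneg indicator_def)

lemma restrict_to_cubes_eq:
  assumes "finite F" "F \<subseteq> basis_lattice"
  shows "of_bool (floor_vec x \<in> F) * h x = (\<Sum>k\<in>F. indicator unit_cube (x - k) * h x)"
proof -
  have "(\<Sum>k\<in>F. indicator unit_cube (x - k) * h x) = (\<Sum>k\<in>F. if k = floor_vec x then h x else 0)"
    using assms diff_in_unit_cube_iff by (intro sum.cong) (auto simp: indicator_def)
  then show ?thesis
    using assms by simp
qed

lemma integrable_on_cubes:
  assumes "finite F" "F \<subseteq> basis_lattice"
  shows "integrable lebesgue (\<lambda>x. of_bool (floor_vec x \<in> F) * h x)"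
  unfolding restrict_to_cubes_eq[OF assms]
  by (intro Bochner_Integration.integrable_sum integrable_on_cube)

text \<open>Averaging \<open>sum_increments_shift\<close> over u in the unit cube: the terms
  \<open>h (k + u)\<close> become the integral over the cubes with corners in F, and
  \<open>h k\<close> is unchanged because the cube has measure 1.\<close>

lemma finite_sum_comparison:
  assumes F: "finite F" "F \<subseteq> basis_lattice" and s: "\<bar>s\<bar> = 1"
  shows "s * ((LINT x|lebesgue. of_bool (floor_vec x \<in> F) * h x) - (\<Sum>k\<in>F. h k)) \<le> (\<Sum>b\<in>Basis. S b)"
proof -
  let ?I = "indicator unit_cube :: 'a \<Rightarrow> real"
  have int_shift: "integrable lebesgue (\<lambda>u. ?I u * h (k + u))"
    and shift: "(LINT u|lebesgue. ?I u * h (k + u)) = (LINT x|lebesgue. ?I (x - k) * h x)" for k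
    using integrable_lebesgue_affine[OF integrable_on_cube[of k], of 1 k]
      integral_lebesgue_affine[OF integrable_on_cube[of k], of 1 k]
    by simp_all
  have const: "integrable lebesgue (\<lambda>u. ?I u * c)" "(LINT u|lebesgue. ?I u * c) = c" for c
    using has_bochner_integral_unit_cube[where 'a = 'a, of c] by (auto simp: has_bochner_integral_iff)
  have "s * ((LINT x|lebesgue. of_bool (floor_vec x \<in> F) * h x) - (\<Sum>k\<in>F. h k))
      = (LINT u|lebesgue. s * (\<Sum>k\<in>F. ?I u * h (k + u) - ?I u * h k))"
  proof -
    have "(LINT u|lebesgue. (\<Sum>k\<in>F. ?I u * h (k + u) - ?I u * h k))
        = (\<Sum>k\<in>F. (LINT u|lebesgue. ?I u * h (k + u)) - (LINT u|lebesgue. ?I u * h k))"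
      by (subst Bochner_Integration.integral_sum)
        (intro Bochner_Integration.integrable_diff int_shift const sum.cong refl
          Bochner_Integration.integral_diff)+
    from this[unfolded const shift] show ?thesis
      unfolding restrict_to_cubes_eq[OF F] by (subst Bochner_Integration.integral_sum) (simp_all add: integrable_on_cube sum_subtractf)
  qed
  also have "\<dots> \<le> (LINT u|lebesgue. ?I u * (\<Sum>b\<in>Basis. S b))"
  proof (intro integral_mono const integrable_mult_right Bochner_Integration.integrable_sum
      Bochner_Integration.integrable_diff int_shift)
    fix u :: 'a
    have "s * (\<Sum>k\<in>F. ?I u * h (k + u) - ?I u * h k) = ?I u * (\<Sum>k\<in>F. s * (h (k + u) - h k))"
      by (simp add: sum_distrib_left algebra_simps)
    also have "\<dots> \<le> ?I u * (\<Sum>b\<in>Basis. S b)"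
      using sum_increments_shift[OF F _ s, of u] unit_cube_subset_cbox by (auto simp: indicator_def)
    finally show "s * (\<Sum>k\<in>F. ?I u * h (k + u) - ?I u * h k) \<le> ?I u * (\<Sum>b\<in>Basis. S b)" .
  qed
  also have "\<dots> = (\<Sum>b\<in>Basis. S b)"
    by (rule const)
  finally show "s * ((LINT x|lebesgue. of_bool (floor_vec x \<in> F) * h x) - (\<Sum>k\<in>F. h k))
      \<le> (\<Sum>b\<in>Basis. S b)" .
qed

text \<open>Uniform in F, hence the source of both summability and the upper half of the
  comparison.\<close>

lemma finite_lattice_sum_le:
  assumes F: "finite F" "F \<subseteq> basis_lattice"
  shows "(\<Sum>k\<in>F. h k) \<le> (LINT x|lebesgue. h x) + (\<Sum>b\<in>Basis. S b)"
proof -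
  have "(LINT x|lebesgue. of_bool (floor_vec x \<in> F) * h x) \<le> (LINT x|lebesgue. h x)"
    by (intro integral_mono integrable_on_cubes F integrable) (auto simp: nonneg)
  then show ?thesis
    using finite_sum_comparison[OF F, of "- 1"] by simp
qed

lemma summable_on_lattice: "h summable_on basis_lattice"
  by (rule nonneg_bdd_above_summable_on) (auto intro!: bdd_aboveI2 finite_lattice_sum_le nonneg)

text \<open>For the lower half the cubes over growing lattice boxes exhaust the space, so their
  integrals converge to the full one by dominated convergence with h itself as majorant.\<close>

lemma lattice_sum_comparison:
  "\<bar>(\<Sum>\<^sub>\<infinity>k\<in>basis_lattice. h k) - (LINT x|lebesgue. h x)\<bar> \<le> (\<Sum>b\<in>Basis. S b)"
proof -
  let ?F = "\<lambda>n. {k \<in> basis_lattice. \<forall>b\<in>Basis. \<bar>k \<bullet> b\<bar> \<le> real n} :: 'a set"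
  have F: "finite (?F n)" "?F n \<subseteq> basis_lattice" for n
    using finite_lattice_box by auto
  have up: "(\<Sum>\<^sub>\<infinity>k\<in>basis_lattice. h k) \<le> (LINT x|lebesgue. h x) + (\<Sum>b\<in>Basis. S b)"
    by (intro infsum_le_finite_sums summable_on_lattice finite_lattice_sum_le)
  have "(LINT x|lebesgue. of_bool (floor_vec x \<in> ?F n) * h x)
      \<le> (\<Sum>\<^sub>\<infinity>k\<in>basis_lattice. h k) + (\<Sum>b\<in>Basis. S b)" for n
  proof -
    have "(\<Sum>k\<in>?F n. h k) \<le> (\<Sum>\<^sub>\<infinity>k\<in>basis_lattice. h k)"
      by (intro finite_sum_le_infsum summable_on_lattice F nonneg)
    then show ?thesis
      using finite_sum_comparison[OF F, of 1 n] by auto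
  qed
  moreover have "(\<lambda>n. LINT x|lebesgue. of_bool (floor_vec x \<in> ?F n) * h x)
      \<longlonglongrightarrow> (LINT x|lebesgue. h x)"
  proof (rule integral_dominated_convergence[where w = h])
    show "AE x in lebesgue. (\<lambda>n. of_bool (floor_vec x \<in> ?F n) * h x) \<longlonglongrightarrow> h x"
    proof (rule AE_I2)
      fix x :: 'a
      obtain N :: nat where N: "norm (floor_vec x) \<le> real N"
        using real_arch_simple by blast
      have "floor_vec x \<in> ?F n" if "N \<le> n" for n
        using that N Basis_le_norm[of _ "floor_vec x"] floor_vec_in_lattice[of x] by force
      then have "eventually (\<lambda>n. of_bool (floor_vec x \<in> ?F n) * h x = h x) sequentially"
        by (intro eventually_sequentiallyI[of N]) auto
      then show "(\<lambda>n. of_bool (floor_vec x \<in> ?F n) * h x) \<longlonglongrightarrow> h x"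
        by (rule tendsto_eventually)
    qed
    show "(\<lambda>x. of_bool (floor_vec x \<in> ?F n) * h x) \<in> borel_measurable lebesgue" for n
      by (intro borel_measurable_integrable integrable_on_cubes F)
  qed (use integrable in \<open>auto simp: nonneg\<close>)
  ultimately have "(LINT x|lebesgue. h x) \<le> (\<Sum>\<^sub>\<infinity>k\<in>basis_lattice. h k) + (\<Sum>b\<in>Basis. S b)"
    by (intro LIMSEQ_le_const2) auto
  with up show ?thesis
    by linarith
qed

end

section \<open>First moments in dimension one\<close>

lemma quasi_concave_uminus:
  assumes "quasi_concave g"
  shows "quasi_concave (\<lambda>x. g (- x))"
  unfolding quasi_concave_def
proof (intro allI ballI)
  fix x y :: 'a and t :: real
  assume "t \<in> {0..1}"
  then show "min (g (- x)) (g (- y)) \<le> g (- ((1 - t) *\<^sub>R x + t *\<^sub>R y))"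
    using quasi_concaveD[OF assms, of t "- x" "- y"] by (simp add: algebra_simps)
qed

lemma powr_concave_uminus:
  assumes "powr_concave g"
  shows "powr_concave (\<lambda>x. g (- x))"
  unfolding powr_concave_def
proof (intro conjI allI ballI)
  fix x y :: 'a and t :: real
  assume "t \<in> {0..1}"
  then show "g (- x) powr (1 - t) * g (- y) powr t \<le> g (- ((1 - t) *\<^sub>R x + t *\<^sub>R y))"
    using powr_concaveD[OF assms, of t "- x" "- y"] by (simp add: algebra_simps)
qed (rule powr_concave_nonneg[OF assms])

lemma has_bochner_integral_lebesgue_uminus:
  fixes h :: "'a::euclidean_space \<Rightarrow> real"
  assumes "has_bochner_integral lebesgue h c"
  shows "has_bochner_integral lebesgue (\<lambda>x. h (- x)) c"
  using integrable_lebesgue_affine[of h "-1" 0] integral_lebesgue_affine[of h "-1" 0] assms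
  by (simp add: has_bochner_integral_iff)

section \<open>Exponential comparison functions and the bound by \<open>exp 1 * g 0\<close>\<close>

lemma has_bochner_integral_x_exp_minus:
  fixes r :: real
  assumes "r > 0"
  shows "has_bochner_integral lebesgue (\<lambda>x. indicator {0..} x * (x * exp (- (r * x)))) (1 / r\<^sup>2)"
proof -
  let ?F = "\<lambda>x. - (x / r + 1 / r\<^sup>2) * exp (- (r * x))"
  have "(\<integral>\<^sup>+ x. ennreal (x * exp (- (r * x))) * indicator {0..} x \<partial>lborel) = ennreal (0 - ?F 0)"
  proof (rule nn_integral_FTC_atLeast)
    show "(?F \<longlongrightarrow> 0) at_top"
    proof -
      have "filterlim (\<lambda>x. r * x) at_top at_top"
        using assms by (intro filterlim_tendsto_pos_mult_at_top[OF tendsto_const _ filterlim_ident])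
      note lim = filterlim_compose[OF tendsto_power_div_exp_0 this]
      have "((\<lambda>x. - (1 / r\<^sup>2) * ((r * x) ^ 1 / exp (r * x) + (r * x) ^ 0 / exp (r * x)))
          \<longlongrightarrow> - (1 / r\<^sup>2) * (0 + 0)) at_top"
        by (intro tendsto_intros lim)
      then show ?thesis
        using assms by (simp add: exp_minus field_simps power2_eq_square)
    qed
    show "(?F has_real_derivative x * exp (- (r * x))) (at x)" for x
      using assms by (auto intro!: derivative_eq_intros simp: field_simps power2_eq_square)
  qed auto
  moreover have "ennreal (x * exp (- (r * x))) * indicator {0..} x
      = ennreal (indicator {0..} x * (x * exp (- (r * x))))" for x
    by (auto simp: indicator_def)
  ultimately have "(\<integral>\<^sup>+ x. ennreal (indicator {0..} x * (x * exp (- (r * x)))) \<partial>lborel) = ennreal (1 / r\<^sup>2)"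
    by simp
  then have "has_bochner_integral lborel (\<lambda>x. indicator {0..} x * (x * exp (- (r * x)))) (1 / r\<^sup>2)"
    by (intro has_bochner_integral_nn_integral) (auto simp: indicator_def)
  then show ?thesis
    by (auto simp: has_bochner_integral_iff integrable_completion integral_completion)
qed

lemma has_bochner_integral_x_exp_Icc:
  fixes r m :: real
  assumes "r > 0" "m > 0"
  shows "has_bochner_integral lebesgue (\<lambda>x. indicator {0..m} x * (x * exp (r * x)))
    ((m / r - 1 / r\<^sup>2) * exp (r * m) + 1 / r\<^sup>2)"
proof -
  let ?F = "\<lambda>x. (x / r - 1 / r\<^sup>2) * exp (r * x)"
  have "has_bochner_integral lborel (\<lambda>x. (x * exp (r * x)) * indicator {0..m} x) (?F m - ?F 0)"
  proof (rule has_bochner_integral_FTC_Icc_nonneg)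
    show "(?F has_real_derivative x * exp (r * x)) (at x)" for x
      using assms by (auto intro!: derivative_eq_intros simp: field_simps power2_eq_square)
  qed (use assms in auto)
  then show ?thesis
    by (auto simp: has_bochner_integral_iff integrable_completion integral_completion mult.commute)
qed

text \<open>If g 0 = 0, quasi-concavity confines the positive values of g to one side of 0. Then x g
  x has constant sign s, and a vanishing integral forces g = 0 almost everywhere.\<close>

lemma centered_powr_concave_pos_at_0:
  fixes g :: "real \<Rightarrow> real"
  assumes g: "powr_concave g" and int: "integrable lebesgue g" and pos: "(LINT x|lebesgue. g x) > 0"
    and cent: "has_bochner_integral lebesgue (\<lambda>x. x * g x) 0"
  shows "g 0 > 0"
proof (rule ccontr)
  assume "\<not> g 0 > 0"
  then have g0: "g 0 = 0"
    using powr_concave_nonneg[OF g, of 0] by auto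
  have qc: "min (g x) (g y) \<le> 0" if "x < 0" "0 < y" for x y
    using quasi_concave_between[OF powr_concave_imp_quasi_concave[OF g], of x 0 y] that g0 by auto
  obtain s :: real where s: "\<bar>s\<bar> = 1" "\<And>x. 0 \<le> s * (x * g x)"
  proof (cases "\<exists>y>0. g y > 0")
    case True
    then have "g x = 0" if "x < 0" for x
      using qc[OF that] powr_concave_nonneg[OF g, of x] by force
    then have "0 \<le> 1 * (x * g x)" for x
      using powr_concave_nonneg[OF g, of x] by (cases "x < 0") auto
    then show ?thesis
      using that[of 1] by simp
  next
    case False
    then have "g x = 0" if "x > 0" for x
      using that powr_concave_nonneg[OF g, of x] by force
    then have "0 \<le> -1 * (x * g x)" for x
      using powr_concave_nonneg[OF g, of x] by (cases "x > 0") (auto simp: mult_nonpos_nonneg)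
    then show ?thesis
      using that[of "-1"] by simp
  qed
  have "has_bochner_integral lebesgue (\<lambda>x. s * (x * g x)) (s * 0)"
    by (intro has_bochner_integral_mult_right cent)
  then have "AE x in lebesgue. s * (x * g x) = 0"
    using s(2) by (subst integral_nonneg_eq_0_iff_AE[symmetric]) (auto simp: has_bochner_integral_iff)
  moreover have "AE x in lebesgue. x \<noteq> (0::real)"
    by (intro AE_completion AE_lborel_singleton)
  ultimately have "AE x in lebesgue. g x = 0"
    by eventually_elim (use s(1) in auto)
  then have "(LINT x|lebesgue. g x) = 0"
    using int by (subst integral_nonneg_eq_0_iff_AE) (auto simp: powr_concave_nonneg[OF g])
  with pos show False
    by simp
qed

(* If g m > e g 0 with m > 0, log-concavity gives g \<ge> g 0 exp (r x) on [0, m] and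
   g \<le> g 0 exp (r x) for x < 0, where r m = ln (g m / g 0) > 1; integrating x g x then gives
   more than 0. *)
lemma centered_powr_concave_le_right:
  fixes g :: "real \<Rightarrow> real"
  assumes g: "powr_concave g" and g0: "g 0 > 0"
    and cent: "has_bochner_integral lebesgue (\<lambda>x. x * g x) 0" and m: "m > 0"
  shows "g m \<le> exp 1 * g 0"
proof (rule ccontr)
  assume "\<not> g m \<le> exp 1 * g 0"
  then have gm: "exp 1 * g 0 < g m"
    by simp
  then have gm0: "g m > 0"
    using g0 by (meson exp_gt_zero mult_pos_pos order_less_trans)
  define a where "a = ln (g m / g 0)"
  have "exp 1 < g m / g 0"
    using gm g0 by (simp add: field_simps)
  then have a: "a > 1"
    using g0 gm0 ln_less_cancel_iff[of "exp 1" "g m / g 0"] by (simp add: a_def)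
  have gm_eq: "g m = g 0 * exp a"
    using g0 gm0 by (simp add: a_def)
  define r where "r = a / m"
  have r: "r > 0" "r * m = a"
    using a m by (auto simp: r_def)
  have left: "g x \<le> g 0 * exp (r * x)" if x: "x < 0" for x
  proof (cases "g x = 0")
    case False
    then have gx: "g x > 0"
      using powr_concave_nonneg[OF g, of x] by auto
    define t where "t = - x / (m - x)"
    have t: "0 \<le> t" "t < 1"
      using x m by (auto simp: t_def field_simps)
    have "t * (m - x) = - x"
      using x m by (simp add: t_def)
    then have z: "(1 - t) *\<^sub>R x + t *\<^sub>R m = 0" and tm: "t * m = - (1 - t) * x"
      by (auto simp: algebra_simps)
    have "g x powr (1 - t) * g m powr t \<le> g 0"
      using powr_concaveD[OF g, of t x m] t by (simp only: z)
    then have "ln (g x powr (1 - t) * g m powr t) \<le> ln (g 0)"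
      using gx gm0 g0 by (subst ln_le_cancel_iff) auto
    then have "(1 - t) * ln (g x) + t * ln (g m) \<le> ln (g 0)"
      using gx gm0 by (simp add: ln_mult ln_powr)
    moreover have "ln (g m) = ln (g 0) + r * m"
      using g0 gm0 by (simp add: a_def ln_div r)
    ultimately have "(1 - t) * ln (g x) + t * (r * m) \<le> (1 - t) * ln (g 0)"
      by (simp add: algebra_simps)
    moreover have "t * (r * m) = - (1 - t) * (r * x)"
      using tm by (metis (no_types, lifting) mult.assoc mult.commute)
    ultimately have "(1 - t) * ln (g x) \<le> (1 - t) * (ln (g 0) + r * x)"
      by (simp add: algebra_simps)
    then have "ln (g x) \<le> ln (g 0) + r * x"
      using t by (simp add: mult_le_cancel_left)
    then have "exp (ln (g x)) \<le> exp (ln (g 0) + r * x)"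
      by simp
    then show ?thesis
      using gx g0 by (simp add: exp_add)
  qed (use g0 in auto)
  have right: "g 0 * exp (r * x) \<le> g x" if x: "0 \<le> x" "x \<le> m" for x
  proof -
    define t where "t = x / m"
    have t: "0 \<le> t" "t \<le> 1" "(1 - t) *\<^sub>R 0 + t *\<^sub>R m = x"
      using x m by (auto simp: t_def field_simps)
    have "g 0 * exp (r * x) = g 0 powr (1 - t) * g m powr t"
    proof -
      have "g 0 powr (1 - t) * g m powr t = (g 0 powr (1 - t) * g 0 powr t) * exp a powr t"
        using g0 by (simp add: gm_eq powr_mult)
      also have "\<dots> = g 0 * exp (a * t)"
      proof -
        have "g 0 powr (1 - t) * g 0 powr t = g 0"
          using g0 by (simp flip: powr_add)
        then show ?thesis
          by (simp add: powr_def mult.commute)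
      qed
      also have "a * t = r * x"
        by (simp add: r_def t_def)
      finally show ?thesis ..
    qed
    also have "\<dots> \<le> g x"
      using powr_concaveD[OF g, of t 0 m] t by simp
    finally show ?thesis .
  qed
  let ?p = "\<lambda>x. indicator {0..m} x * (x * exp (r * x)) :: real"
  \<comment> \<open>The first moment density of exp (r x) on the negative half-line, as a reflection
    of the integrand already computed. Its integral \<open>1 / r\<^sup>2\<close> cancels the same
    term in the integral of \<open>?p\<close>.\<close>
  let ?n = "\<lambda>x. indicator {0..} (- x) * (- x * exp (- (r * - x))) :: real"
  have "has_bochner_integral lebesgue (\<lambda>x. g 0 * (?p x - ?n x))
      (g 0 * ((m / r - 1 / r\<^sup>2) * exp (r * m) + 1 / r\<^sup>2 - 1 / r\<^sup>2))"
    by (intro has_bochner_integral_mult_right has_bochner_integral_diff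
        has_bochner_integral_x_exp_Icc r m
        has_bochner_integral_lebesgue_uminus[OF has_bochner_integral_x_exp_minus])
  moreover have "g 0 * (?p x - ?n x) \<le> x * g x" for x
  proof -
    consider "x < 0" | "x = 0" | "0 < x" "x \<le> m" | "x > m"
      by linarith
    then show ?thesis
    proof cases
      case 1
      then have "x * (g 0 * exp (r * x)) \<le> x * g x"
        using left[of x] by (intro mult_left_mono_neg) auto
      then show ?thesis
        using 1 by (simp add: indicator_def algebra_simps)
    next
      case 3
      then have "x * (g 0 * exp (r * x)) \<le> x * g x"
        using right[of x] by (intro mult_left_mono) auto
      then show ?thesis
        using 3 by (simp add: indicator_def algebra_simps)
    next
      case 4
      then show ?thesis
        using m powr_concave_nonneg[OF g, of x] by (simp add: indicator_def)
    qed auto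
  qed
  ultimately have "g 0 * ((m / r - 1 / r\<^sup>2) * exp (r * m) + 1 / r\<^sup>2 - 1 / r\<^sup>2) \<le> 0"
    using cent integral_mono[of lebesgue "\<lambda>x. g 0 * (?p x - ?n x)" "\<lambda>x. x * g x"]
    unfolding has_bochner_integral_iff by metis
  \<comment> \<open>This is r m = a > 1, the point where the constant e enters.\<close>
  moreover have "1 / r\<^sup>2 < m / r"
    using r a by (simp add: field_simps power2_eq_square)
  then have "0 < g 0 * ((m / r - 1 / r\<^sup>2) * exp (r * m))"
    using g0 by simp
  ultimately show False
    by simp
qed

lemma centered_powr_concave_le:
  fixes g :: "real \<Rightarrow> real"
  assumes g: "powr_concave g" and g0: "g 0 > 0"
    and cent: "has_bochner_integral lebesgue (\<lambda>x. x * g x) 0"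
  shows "g x \<le> exp 1 * g 0"
proof -
  have "has_bochner_integral lebesgue (\<lambda>x. - (- x * g (- x))) (- 0)"
    by (intro has_bochner_integral_minus has_bochner_integral_lebesgue_uminus[OF cent])
  then have "g (- (- x)) \<le> exp 1 * g (- 0)" if "x < 0"
    using that g0 by (intro centered_powr_concave_le_right[where g = "\<lambda>x. g (- x)"] powr_concave_uminus g) auto
  moreover have "g 0 \<le> exp 1 * g 0"
    using g0 by (simp add: mult_le_cancel_right1)
  ultimately show ?thesis
    using centered_powr_concave_le_right[OF assms, of x] by (cases x "0 :: real" rule: linorder_cases) auto
qed

section \<open>First moments over the integers\<close>

lemma basis_lattice_real: "basis_lattice = (\<int> :: real set)"
  by (auto simp: basis_lattice_def)

text \<open>The line has a single parallel: \<open>k \<bullet> b = 0\<close> leaves only k = 0, so a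
  global bound for h serves as both \<open>H\<close> and \<open>S\<close>.\<close>

lemma
  fixes h :: "real \<Rightarrow> real"
  assumes h: "quasi_concave h" "\<And>x. 0 \<le> h x" "integrable lebesgue h" and B: "\<And>x. h x \<le> B"
  shows summable_on_Ints_quasi_concave: "h summable_on \<int>"
    and Ints_sum_comparison: "\<bar>(\<Sum>\<^sub>\<infinity>k\<in>\<int>. h k) - (LINT x|lebesgue. h x)\<bar> \<le> B"
proof -
  have "0 \<le> B"
    using h(2)[of 0] B[of 0] by linarith
  interpret lattice_comparison h "\<lambda>_ _. B" "\<lambda>_. B"
  proof
    fix b v :: real and F :: "real set"
    assume "b \<in> Basis" "finite F" "\<And>k. k \<in> F \<Longrightarrow> k \<bullet> b = 0"
    then have "F \<subseteq> {0}"
      by auto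
    then show "(\<Sum>k\<in>F. B) \<le> B"
      using \<open>0 \<le> B\<close> by (auto simp: subset_singleton_iff)
  qed (use h B in auto)
  show "h summable_on \<int>" "\<bar>(\<Sum>\<^sub>\<infinity>k\<in>\<int>. h k) - (LINT x|lebesgue. h x)\<bar> \<le> B"
    using summable_on_lattice lattice_sum_comparison by (auto simp: basis_lattice_real)
qed

text \<open>At each of the floor(x) + 1 > x integers k of [0, x], quasi-concavity gives g k \<ge>
  min (g 0) (g x), and c times this minimum is at least g x. Summing over k replaces the factor x by
  the number of terms.\<close>

lemma mult_quasi_concave_le_Ints_sum:
  fixes g :: "real \<Rightarrow> real"
  assumes g: "quasi_concave g" and g0: "\<And>x. 0 \<le> g x" and sum: "g summable_on \<int>"
    and c: "1 \<le> c" "\<And>x. 0 < x \<Longrightarrow> g x \<le> c * g 0"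
  shows "max 0 x * g x \<le> c * (\<Sum>\<^sub>\<infinity>k\<in>\<int>. g k)"
proof (cases "x > 0")
  case True
  let ?F = "(of_int :: int \<Rightarrow> real) ` {0..\<lfloor>x\<rfloor>}"
  have "g x \<le> c * g k" if "k \<in> ?F" for k
  proof -
    have "0 \<le> k" "k \<le> x"
      using that by (auto simp: le_floor_iff)
    then have "min (g 0) (g x) \<le> g k"
      by (intro quasi_concave_between[OF g])
    then have "c * min (g 0) (g x) \<le> c * g k"
      using c by (intro mult_left_mono) auto
    moreover have "g x \<le> c * g x"
      using mult_right_mono[OF c(1) g0[of x]] by simp
    ultimately show ?thesis
      using c(2)[OF True] by (auto simp: min_def split: if_splits)
  qed
  then have "(\<Sum>k\<in>?F. g x) \<le> (\<Sum>k\<in>?F. c * g k)"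
    by (intro sum_mono)
  moreover have "(\<Sum>k\<in>?F. g x) = (of_int \<lfloor>x\<rfloor> + 1) * g x"
    using True by (simp add: card_image inj_on_def)
  moreover have "x * g x \<le> (of_int \<lfloor>x\<rfloor> + 1) * g x"
    by (intro mult_right_mono g0) linarith
  moreover have "(\<Sum>k\<in>?F. g k) \<le> (\<Sum>\<^sub>\<infinity>k\<in>\<int>. g k)"
    by (intro finite_sum_le_infsum sum g0) auto
  then have "c * (\<Sum>k\<in>?F. g k) \<le> c * (\<Sum>\<^sub>\<infinity>k\<in>\<int>. g k)"
    using c by (intro mult_left_mono) auto
  moreover have "max 0 x * g x = x * g x"
    using True by simp
  ultimately show ?thesis
    unfolding sum_distrib_left by linarith
next
  case False
  then show ?thesis
    using c g0 infsum_nonneg[of \<int> g] by (simp add: max_def)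
qed

lemma infsum_Ints_uminus: "(\<Sum>\<^sub>\<infinity>k\<in>(\<int> :: real set). g (- k)) = (\<Sum>\<^sub>\<infinity>k\<in>\<int>. g k)"
  by (rule infsum_reindex_bij_witness[of _ uminus uminus]) auto

lemma first_moment_Ints:
  fixes g :: "real \<Rightarrow> real"
  assumes g: "powr_concave g" and int: "integrable lebesgue g" and pos: "(LINT x|lebesgue. g x) > 0"
    and cent: "has_bochner_integral lebesgue (\<lambda>x. x * g x) 0"
  shows "g summable_on \<int>" "(\<lambda>k. k * g k) summable_on \<int>"
    "\<bar>(LINT x|lebesgue. x * g x) - (\<Sum>\<^sub>\<infinity>k\<in>\<int>. k * g k)\<bar> \<le> (exp 1 + 1) * (\<Sum>\<^sub>\<infinity>k\<in>\<int>. g k)"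
proof -
  note nonneg = powr_concave_nonneg[OF g]
  have g0: "g 0 > 0"
    by (rule centered_powr_concave_pos_at_0[OF assms])
  note le = centered_powr_concave_le[OF g g0 cent]
  have qc: "quasi_concave g"
    by (rule powr_concave_imp_quasi_concave[OF g])
  show sum: "g summable_on \<int>"
    by (rule summable_on_Ints_quasi_concave[OF qc nonneg int le])
  then have sum': "(\<lambda>x. g (- x)) summable_on \<int>"
    by (subst summable_on_reindex_bij_witness[of _ uminus uminus _ g]) auto
  let ?S = "\<Sum>\<^sub>\<infinity>k\<in>\<int>. g k"
  \<comment> \<open>If g exceeded g 0 on both sides, quasi-concavity would fail at 0. So one
    half-line takes the constant 1 and the other takes e, which gives c + c' = e + 1.\<close>
  have "(\<forall>x>0. g x \<le> 1 * g 0) \<or> (\<forall>x>0. g (- x) \<le> 1 * g (- 0))"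
  proof (rule ccontr)
    assume "\<not> ?thesis"
    then obtain x y where "x > 0" "g x > g 0" "y > 0" "g (- y) > g 0"
      by (auto simp: not_le)
    then show False
      using quasi_concave_between[OF qc, of "- y" 0 x] by auto
  qed
  then obtain c c' where c: "1 \<le> c" "\<And>x. 0 < x \<Longrightarrow> g x \<le> c * g 0"
    and c': "1 \<le> c'" "\<And>x. 0 < x \<Longrightarrow> g (- x) \<le> c' * g (- 0)" and cc': "c + c' = exp 1 + 1"
  proof
    assume *: "\<forall>x>0. g x \<le> 1 * g 0"
    show thesis
      by (rule that[of 1 "exp 1"]) (use * le in auto)
  next
    assume *: "\<forall>x>0. g (- x) \<le> 1 * g (- 0)"
    show thesis
      by (rule that[of "exp 1" 1]) (use * le in auto)
  qed
  let ?p = "\<lambda>x. max 0 x * g x" and ?n = "\<lambda>x. max 0 (- x) * g x"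
  have B: "?p x \<le> c * ?S" for x
    by (rule mult_quasi_concave_le_Ints_sum[OF qc nonneg sum c])
  have "max 0 (- x) * g (- (- x)) \<le> c' * (\<Sum>\<^sub>\<infinity>k\<in>\<int>. g (- k))" for x
    by (rule mult_quasi_concave_le_Ints_sum[OF quasi_concave_uminus[OF qc] nonneg sum' c'])
  then have B': "?n x \<le> c' * ?S" for x
    by (simp add: infsum_Ints_uminus)
  have int_x: "integrable lebesgue (\<lambda>x. x * g x)"
    using cent by (auto simp: has_bochner_integral_iff)
  have [measurable]: "g \<in> borel_measurable lebesgue"
    using int by auto
  have p_eq: "?p = (\<lambda>x. max 0 (x * g x))" and n_eq: "?n = (\<lambda>x. max 0 (- (x * g x)))"
    using nonneg by (auto simp: max_def fun_eq_iff zero_le_mult_iff mult_le_0_iff)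
      (metis nonneg mult_nonneg_nonneg mult_nonpos_nonneg linear order.antisym mult_eq_0_iff)+
  have int': "integrable lebesgue ?p" "integrable lebesgue ?n"
    unfolding p_eq n_eq using int_x by (auto intro!: integrable_max)
  have lin: "linear (\<lambda>x. x :: real)" "linear (\<lambda>x. - x :: real)"
    by (auto intro!: linearI)
  have qc': "quasi_concave ?p" "quasi_concave ?n"
    by (intro powr_concave_imp_quasi_concave powr_concave_mult g powr_concave_pos_part_linear lin)+
  have nn: "0 \<le> ?p x" "0 \<le> ?n x" for x
    using nonneg by auto
  note sums = summable_on_Ints_quasi_concave[OF qc'(1) nn(1) int'(1) B]
    summable_on_Ints_quasi_concave[OF qc'(2) nn(2) int'(2) B']
  note cmp = Ints_sum_comparison[OF qc'(1) nn(1) int'(1) B]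
    Ints_sum_comparison[OF qc'(2) nn(2) int'(2) B']
  have eq: "x * g x = ?p x - ?n x" for x
    by (auto simp: max_def)
  show "(\<lambda>k. k * g k) summable_on \<int>"
    using summable_on_add[OF sums(1) summable_on_uminus[THEN iffD2, OF sums(2)]] by (simp add: eq)
  have "(LINT x|lebesgue. x * g x) = (LINT x|lebesgue. ?p x) - (LINT x|lebesgue. ?n x)"
    unfolding eq by (intro Bochner_Integration.integral_diff int')
  moreover have "(\<Sum>\<^sub>\<infinity>k\<in>\<int>. k * g k) = (\<Sum>\<^sub>\<infinity>k\<in>\<int>. ?p k) - (\<Sum>\<^sub>\<infinity>k\<in>\<int>. ?n k)"
    using infsum_add[OF sums(1) summable_on_uminus[THEN iffD2, OF sums(2)]]
    by (simp add: eq infsum_uminus)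
  moreover have "(exp 1 + 1) * ?S = c * ?S + c' * ?S"
    by (simp only: cc'[symmetric] distrib_right)
  ultimately show "\<bar>(LINT x|lebesgue. x * g x) - (\<Sum>\<^sub>\<infinity>k\<in>\<int>. k * g k)\<bar> \<le> (exp 1 + 1) * ?S"
    using cmp by linarith
qed

section \<open>Isotropic log-concave densities\<close>

text \<open>The level \<tau> with sqrt \<tau> * 2^n = 1/4: since f \<le> sqrt \<tau> * sqrt (M f)
  where f \<le> \<tau> M, that region carries at most a quarter of the mass.\<close>

definition level_const :: "nat \<Rightarrow> real" where
  "level_const n = 1 / (16 * 4 ^ n)"

text \<open>The bound on c / \<sigma> obtained by solving (c - 2 \<sigma>)^2 \<le> 2 * 2^n * e /
  \<tau> * \<sigma>^2 with \<tau> = \<open>level_const n\<close>.\<close>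

definition decay_const :: "nat \<Rightarrow> real" where
  "decay_const n = 2 + sqrt (2 * 2 ^ n * exp 1 / level_const n)"

text \<open>The truncation point a, in units of \<sigma>. With D = 8 * \<open>decay_const n\<close>
  it satisfies a^2 = 2 * 2^n * D^4, so that the fourth moment tail takes at most half of the
  variance.\<close>

definition abs_moment_const :: "nat \<Rightarrow> real" where
  "abs_moment_const n = sqrt (2 * 2 ^ n) * (8 * decay_const n)\<^sup>2"

text \<open>This radius and the next level make each of the two error terms in the separation
  argument equal to \<sigma> / (16 a), where a = \<open>abs_moment_const n\<close>; together they
  stay below the required \<sigma> / (4 a).\<close>

definition inradius_const :: "nat \<Rightarrow> real" where
  "inradius_const n = 1 / (16 * abs_moment_const n)"

definition inner_level_const :: "nat \<Rightarrow> real" where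
  "inner_level_const n = 1 / (16 * abs_moment_const n * (8 * decay_const n) * 2 ^ n)"

lemma level_const_pos: "0 < level_const n" and level_const_le_1: "level_const n \<le> 1"
proof -
  have "(1::real) \<le> 4 ^ n"
    by simp
  then have "1 \<le> 16 * (4::real) ^ n"
    by linarith
  then show "0 < level_const n" "level_const n \<le> 1"
    by (auto simp: level_const_def)
qed

lemma sqrt_level_const: "sqrt (level_const n) * 2 ^ n = 1 / 4"
proof -
  have "level_const n = (1 / (4 * 2 ^ n))\<^sup>2"
    by (simp add: level_const_def power2_eq_square flip: power_mult_distrib)
  then show ?thesis
    by (simp add: real_sqrt_unique)
qed

lemma decay_const_ge_2: "2 \<le> decay_const n"
  unfolding decay_const_def using level_const_pos[of n] by simp

lemma abs_moment_const_ge_1: "1 \<le> abs_moment_const n"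
proof -
  have "(1::real) \<le> 2 * 2 ^ n"
    by (metis mult_2 one_le_numeral one_le_power order_trans le_add_same_cancel1 zero_le_one)
  then have "1 \<le> sqrt (2 * 2 ^ n)"
    by simp
  moreover have "1 \<le> (8 * decay_const n)\<^sup>2"
    using decay_const_ge_2[of n] by (intro one_le_power) auto
  ultimately show ?thesis
    unfolding abs_moment_const_def using mult_mono[of 1 "sqrt (2 * 2 ^ n)" 1] by auto
qed

lemma inradius_const_pos: "0 < inradius_const n"
  using abs_moment_const_ge_1[of n] by (simp add: inradius_const_def)

lemma inner_level_const_bounds: "0 < inner_level_const n" "inner_level_const n < 1"
proof -
  let ?q = "16 * abs_moment_const n * (8 * decay_const n) * 2 ^ n"
  have "1 * 1 < (16 * abs_moment_const n) * (8 * decay_const n)"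
    using abs_moment_const_ge_1[of n] decay_const_ge_2[of n] by (intro mult_strict_mono) auto
  then have "1 * 1 < ?q"
    by (intro mult_less_le_imp_less) auto
  then show "0 < inner_level_const n" "inner_level_const n < 1"
    by (auto simp: inner_level_const_def)
qed

text \<open>Isotropy read direction by direction. The basis-free form matters because the normal of
  the separating hyperplane used below is arbitrary.\<close>

locale isotropic_density =
  fixes f :: "'a::euclidean_space \<Rightarrow> real" and \<sigma> :: real
  assumes powr_concave: "powr_concave f"
    and total: "has_bochner_integral lebesgue f 1"
    and \<sigma>_pos: "0 < \<sigma>"
    and mean: "has_bochner_integral lebesgue (\<lambda>x. (x \<bullet> \<theta>) * f x) 0"
    and variance: "norm \<theta> = 1 \<Longrightarrow> has_bochner_integral lebesgue (\<lambda>x. (x \<bullet> \<theta>)\<^sup>2 * f x) (\<sigma>\<^sup>2)"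
begin

section \<open>Supremum of f and integral of its square root\<close>

definition M where "M = (SUP x. f x)"

lemma nonneg: "0 \<le> f x"
  by (rule powr_concave_nonneg[OF powr_concave])

lemma integrable_f: "integrable lebesgue f"
  using total by (simp add: has_bochner_integral_iff)

lemma measurable_f [measurable]: "f \<in> borel_measurable lebesgue"
  using integrable_f by auto

lemma sqrt_mult_le_midpoint: "sqrt (f z) * sqrt (f x) \<le> f ((1/2) *\<^sub>R z + (1/2) *\<^sub>R x)"
  using powr_concaveD[OF powr_concave, of "1/2" z x] by (simp add: powr_half_sqrt nonneg)

text \<open>One point z0 with f z0 > 0 already dominates sqrt f by an integrable function. With I >
  0 the integral of sqrt f, the midpoint inequality at an arbitrary z then yields sqrt (f z) \<le>
  2^d / I, so f is bounded and \<open>M\<close> is a genuine supremum.\<close>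

lemma
  shows bdd_above_f: "bdd_above (range f)"
    and M_pos: "0 < M"
    and integrable_sqrt: "integrable lebesgue (\<lambda>x. sqrt (f x))"
    and integral_sqrt_le: "(LINT x|lebesgue. sqrt (M * f x)) \<le> 2 ^ DIM('a)"
proof -
  have not_null: "\<not> (AE x in lebesgue. f x = 0)"
  proof
    assume "AE x in lebesgue. f x = 0"
    then have "(LINT x|lebesgue. f x) = 0"
      using integrable_f nonneg by (subst integral_nonneg_eq_0_iff_AE) auto
    then show False
      using total by (simp add: has_bochner_integral_iff)
  qed
  have "\<exists>z. f z > 0"
  proof (rule ccontr)
    assume "\<not> (\<exists>z. f z > 0)"
    then have "f x = 0" for x
      using nonneg[of x] by (auto simp: order_le_less)
    with not_null show False
      by simp
  qed
  then obtain z0 where z0: "f z0 > 0"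
    by blast
  have mid: "integrable lebesgue (\<lambda>x. f ((1/2) *\<^sub>R z + (1/2) *\<^sub>R x))"
    "(LINT x|lebesgue. f ((1/2) *\<^sub>R z + (1/2) *\<^sub>R x)) = 2 ^ DIM('a)" for z
    using integrable_lebesgue_affine[OF integrable_f, of "1/2" "(1/2) *\<^sub>R z"]
      integral_lebesgue_affine[OF integrable_f, of "1/2" "(1/2) *\<^sub>R z"] total
    by (auto simp: has_bochner_integral_iff power_divide)
  show int: "integrable lebesgue (\<lambda>x. sqrt (f x))"
  proof (rule Bochner_Integration.integrable_bound)
    show "integrable lebesgue (\<lambda>x. f ((1/2) *\<^sub>R z0 + (1/2) *\<^sub>R x) / sqrt (f z0))"
      using mid(1) by simp
    show "AE x in lebesgue. norm (sqrt (f x)) \<le> norm (f ((1/2) *\<^sub>R z0 + (1/2) *\<^sub>R x) / sqrt (f z0))"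
      using z0 sqrt_mult_le_midpoint[of z0] by (intro AE_I2) (simp add: nonneg field_simps)
  qed measurable
  let ?I = "LINT x|lebesgue. sqrt (f x)"
  have I: "?I > 0"
  proof -
    have "?I \<noteq> 0"
      using not_null int nonneg by (subst integral_nonneg_eq_0_iff_AE) auto
    moreover have "?I \<ge> 0"
      by (intro Bochner_Integration.integral_nonneg) (simp add: nonneg)
    ultimately show ?thesis by simp
  qed
  have "sqrt (f z) \<le> 2 ^ DIM('a) / ?I" for z
  proof -
    have "(LINT x|lebesgue. sqrt (f z) * sqrt (f x)) \<le> 2 ^ DIM('a)"
      unfolding mid(2)[of z, symmetric] using int
      by (intro integral_mono mid sqrt_mult_le_midpoint) auto
    then show ?thesis
      using I by (simp add: field_simps)
  qed
  then have bound: "f z \<le> (2 ^ DIM('a) / ?I)\<^sup>2" for z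
    using power_mono[of "sqrt (f z)" _ 2] nonneg[of z] by simp
  then show bdd: "bdd_above (range f)"
    by (intro bdd_aboveI2) auto
  show "0 < M"
    unfolding M_def using z0 by (rule less_le_trans) (auto intro: cSUP_upper bdd)
  have "M \<le> (2 ^ DIM('a) / ?I)\<^sup>2"
    unfolding M_def using bound by (intro cSUP_least) auto
  then have "sqrt M \<le> 2 ^ DIM('a) / ?I"
    using I by (intro real_le_lsqrt) auto
  then show "(LINT x|lebesgue. sqrt (M * f x)) \<le> 2 ^ DIM('a)"
    using I by (simp add: real_sqrt_mult field_simps)
qed

lemma f_le_M: "f x \<le> M"
  unfolding M_def by (intro cSUP_upper bdd_above_f) auto

lemma integrable_sqrt_M: "integrable lebesgue (\<lambda>x. sqrt (M * f x))"
  using integrable_sqrt by (simp add: real_sqrt_mult)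

text \<open>A pointwise Markov inequality: integrated over the region f \<le> t M, it bounds the
  mass there by sqrt t * 2^d.\<close>

lemma f_le_sqrt_level:
  assumes "f y \<le> t * M" "0 \<le> t"
  shows "f y \<le> sqrt t * sqrt (M * f y)"
proof -
  have "f y = sqrt (f y) * sqrt (f y)"
    using nonneg by simp
  also have "\<dots> \<le> sqrt (t * M) * sqrt (f y)"
    using assms nonneg by (intro mult_right_mono) auto
  finally show ?thesis
    by (simp add: real_sqrt_mult mult_ac)
qed

(* Combine x with the bulk {f \<ge> \<tau> M, |y \<bullet> \<theta>| \<le> 2 \<sigma>}: were x far out compared with
   ln (M / f x), the combinations would carry too much variance in direction \<theta>. *)
lemma inner_le_ln:
  assumes \<theta>: "norm \<theta> = 1" and fx: "f x > 0"
  shows "\<bar>x \<bullet> \<theta>\<bar> \<le> decay_const DIM('a) * \<sigma> * (2 + ln (M / f x))"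
proof -
  define Q where "Q = 2 + ln (M / f x)"
  have "1 \<le> M / f x"
    using f_le_M[of x] fx by simp
  then have Q: "2 \<le> Q"
    by (simp add: Q_def)
  \<comment> \<open>The weight of x is small enough that (f x / M)^l \<ge> 1/e, since l * ln (M / f
    x) = (Q - 2) / Q < 1. As l \<le> 1/2, contracting by 1 - l costs at most a factor 2^d.\<close>
  define l where "l = 1 / Q"
  have l: "0 < l" "l \<le> 1/2"
    using Q by (auto simp: l_def field_simps)
  define c where "c = l * \<bar>x \<bullet> \<theta>\<bar>"
  define \<tau> where "\<tau> = level_const DIM('a)"
  have \<tau>: "0 < \<tau>" "\<tau> \<le> 1"
    by (auto simp: \<tau>_def level_const_pos level_const_le_1)
  have "c \<le> decay_const DIM('a) * \<sigma>"
  proof (cases "c \<le> 2 * \<sigma>")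
    case True
    then show ?thesis
      using decay_const_ge_2 \<sigma>_pos by (meson mult_right_mono less_imp_le order_trans)
  next
    case False
    define K where "K = \<tau> / exp 1 * (c - 2 * \<sigma>)\<^sup>2"
    have K: "0 \<le> K"
      using \<tau> by (simp add: K_def)
    let ?z = "\<lambda>y. (1 - l) *\<^sub>R y + l *\<^sub>R x"
    \<comment> \<open>A substitute for K f times the indicator of the bulk: the two subtracted terms
      make it nonpositive off the bulk, by \<open>f_le_sqrt_level\<close> and by Chebyshev at 2
      \<sigma>. Each of them has integral at most 1/4 before the factor K, so the integral of
      \<open>?L\<close> is at least K / 2.\<close>
    let ?L = "\<lambda>y. K * (f y - sqrt \<tau> * sqrt (M * f y) - 1 / (4 * \<sigma>\<^sup>2) * ((y \<bullet> \<theta>)\<^sup>2 * f y))"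
    have pointwise: "?L y \<le> (?z y \<bullet> \<theta>)\<^sup>2 * f (?z y)" for y
    proof -
      have A: "0 \<le> sqrt \<tau> * sqrt (M * f y)"
        using \<tau> M_pos nonneg by simp
      have V: "0 \<le> 1 / (4 * \<sigma>\<^sup>2) * ((y \<bullet> \<theta>)\<^sup>2 * f y)"
        using nonneg by simp
      have RHS: "0 \<le> (?z y \<bullet> \<theta>)\<^sup>2 * f (?z y)"
        using nonneg by simp
      consider "f y \<le> \<tau> * M" | "\<bar>y \<bullet> \<theta>\<bar> > 2 * \<sigma>" | "f y > \<tau> * M" "\<bar>y \<bullet> \<theta>\<bar> \<le> 2 * \<sigma>"
        by linarith
      then show ?thesis
      proof cases
        case 1
        then have "f y \<le> sqrt \<tau> * sqrt (M * f y)"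
          using f_le_sqrt_level \<tau> by auto
        then have "?L y \<le> K * 0"
          using V K by (intro mult_left_mono) auto
        then show ?thesis
          using RHS by simp
      next
        case 2
        then have "(2 * \<sigma>)\<^sup>2 \<le> \<bar>y \<bullet> \<theta>\<bar>\<^sup>2"
          using \<sigma>_pos by (intro power_mono) auto
        then have "1 \<le> 1 / (4 * \<sigma>\<^sup>2) * (y \<bullet> \<theta>)\<^sup>2"
          using \<sigma>_pos by (simp add: field_simps)
        then have "1 * f y \<le> (1 / (4 * \<sigma>\<^sup>2) * (y \<bullet> \<theta>)\<^sup>2) * f y"
          by (intro mult_right_mono nonneg)
        then have "?L y \<le> K * 0"
          using A K by (intro mult_left_mono) auto
        then show ?thesis
          using RHS by simp
      next
        case 3
        have "exp (- 1) \<le> (f x / M) powr l"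
        proof -
          have "(f x / M) powr l = exp (l * ln (f x / M))"
            using fx M_pos by (simp add: powr_def)
          also have "l * ln (f x / M) = - ((Q - 2) / Q)"
          proof -
            have "ln (f x / M) = - (Q - 2)"
              using fx M_pos by (simp add: Q_def ln_div)
            then show ?thesis
              by (simp add: l_def diff_divide_distrib)
          qed
          finally show ?thesis
            using Q by (simp add: field_simps)
        qed
        moreover have "\<tau> \<le> \<tau> powr (1 - l)"
          using powr_mono'[of "1 - l" 1 \<tau>] \<tau> l by simp
        ultimately have "M * (\<tau> * exp (- 1)) \<le> M * (\<tau> powr (1 - l) * (f x / M) powr l)"
          using \<tau> M_pos by (intro mult_left_mono mult_mono) auto
        also have "\<dots> = (\<tau> * M) powr (1 - l) * f x powr l"
        proof -
          have "M = M powr (1 - l) * M powr l"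
            using M_pos by (simp flip: powr_add)
          then show ?thesis
            using \<tau> M_pos fx by (simp add: powr_mult powr_divide field_simps)
        qed
        also have "\<dots> \<le> f y powr (1 - l) * f x powr l"
          using 3 \<tau> M_pos l by (intro mult_right_mono powr_mono2) auto
        also have "\<dots> \<le> f (?z y)"
          using l by (intro powr_concaveD powr_concave) auto
        finally have fz: "M * (\<tau> * exp (- 1)) \<le> f (?z y)" .
        have "\<bar>(1 - l) * (y \<bullet> \<theta>)\<bar> \<le> 1 * (2 * \<sigma>)"
          using 3 l unfolding abs_mult by (intro mult_mono) auto
        moreover have "c = \<bar>l * (x \<bullet> \<theta>)\<bar>"
          using l by (simp add: c_def abs_mult)
        moreover have "?z y \<bullet> \<theta> = (1 - l) * (y \<bullet> \<theta>) + l * (x \<bullet> \<theta>)"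
          by (simp add: inner_add_left)
        ultimately have "\<bar>c - 2 * \<sigma>\<bar> \<le> \<bar>?z y \<bullet> \<theta>\<bar>"
          using False by linarith
        then have z: "(c - 2 * \<sigma>)\<^sup>2 \<le> (?z y \<bullet> \<theta>)\<^sup>2"
          by (simp only: abs_le_square_iff)
        have "?L y \<le> K * f y"
          using A V K by (intro mult_left_mono) auto
        also have "\<dots> \<le> K * M"
          using K f_le_M by (intro mult_left_mono)
        also have "\<dots> = (c - 2 * \<sigma>)\<^sup>2 * (M * (\<tau> * exp (- 1)))"
          by (simp add: K_def exp_minus field_simps)
        also have "\<dots> \<le> (?z y \<bullet> \<theta>)\<^sup>2 * f (?z y)"
          using z fz M_pos \<tau> by (intro mult_mono) auto
        finally show ?thesis .
      qed
    qed
    have var: "integrable lebesgue (\<lambda>x. (x \<bullet> \<theta>)\<^sup>2 * f x)" "(LINT x|lebesgue. (x \<bullet> \<theta>)\<^sup>2 * f x) = \<sigma>\<^sup>2"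
      using variance[OF \<theta>] by (auto simp: has_bochner_integral_iff)
    have z_eq: "?z y = l *\<^sub>R x + (1 - l) *\<^sub>R y" for y
      by (simp add: add.commute)
    have int_R: "integrable lebesgue (\<lambda>y. (?z y \<bullet> \<theta>)\<^sup>2 * f (?z y))"
      unfolding z_eq using integrable_lebesgue_affine[OF var(1), of "1 - l" "l *\<^sub>R x"] l by simp
    have "(LINT y|lebesgue. (?z y \<bullet> \<theta>)\<^sup>2 * f (?z y)) = \<sigma>\<^sup>2 / (1 - l) ^ DIM('a)"
      unfolding z_eq using integral_lebesgue_affine[OF var(1), of "1 - l" "l *\<^sub>R x"] l var(2) by simp
    also have "\<dots> \<le> \<sigma>\<^sup>2 / (1 / 2) ^ DIM('a)"
      using l by (intro divide_left_mono power_mono) auto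
    finally have R: "(LINT y|lebesgue. (?z y \<bullet> \<theta>)\<^sup>2 * f (?z y)) \<le> \<sigma>\<^sup>2 * 2 ^ DIM('a)"
      by (simp add: power_divide)
    have int_L: "integrable lebesgue ?L"
      using integrable_f integrable_sqrt_M var(1) by simp
    have "(LINT y|lebesgue. ?L y)
        = K * (1 - sqrt \<tau> * (LINT y|lebesgue. sqrt (M * f y)) - 1 / (4 * \<sigma>\<^sup>2) * \<sigma>\<^sup>2)"
      using total integrable_f integrable_sqrt_M var by (simp add: has_bochner_integral_iff)
    also have "\<dots> \<ge> K * (1 - 1 / 4 - 1 / 4)"
    proof (intro mult_left_mono diff_mono K)
      have "sqrt \<tau> * (LINT y|lebesgue. sqrt (M * f y)) \<le> sqrt \<tau> * 2 ^ DIM('a)"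
        using \<tau> by (intro mult_left_mono integral_sqrt_le) auto
      then show "sqrt \<tau> * (LINT y|lebesgue. sqrt (M * f y)) \<le> 1 / 4"
        by (simp add: \<tau>_def sqrt_level_const)
    qed (use \<sigma>_pos in auto)
    finally have "K / 2 \<le> (LINT y|lebesgue. ?L y)"
      by simp
    also have "\<dots> \<le> (LINT y|lebesgue. (?z y \<bullet> \<theta>)\<^sup>2 * f (?z y))"
      by (intro integral_mono int_L int_R pointwise)
    also note R
    finally have "(c - 2 * \<sigma>)\<^sup>2 \<le> 2 * 2 ^ DIM('a) * exp 1 / \<tau> * \<sigma>\<^sup>2"
      using \<tau> by (simp add: K_def field_simps)
    then have "c - 2 * \<sigma> \<le> sqrt (2 * 2 ^ DIM('a) * exp 1 / \<tau> * \<sigma>\<^sup>2)"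
      by (intro real_le_rsqrt)
    also have "\<dots> = sqrt (2 * 2 ^ DIM('a) * exp 1 / \<tau>) * \<sigma>"
      using \<sigma>_pos by (simp only: real_sqrt_mult real_sqrt_abs abs_of_pos)
    finally show ?thesis
      unfolding decay_const_def \<tau>_def[symmetric] by (simp add: distrib_right)
  qed
  then have "c * Q \<le> decay_const DIM('a) * \<sigma> * Q"
    using Q by (intro mult_right_mono) auto
  moreover have "c * Q = \<bar>x \<bullet> \<theta>\<bar>"
    using Q by (simp add: c_def l_def)
  ultimately show ?thesis
    by (simp add: Q_def)
qed

(* The exponent makes w^4 f = sqrt (M f) integrable, while ln (M / f) is at most linear in w. *)
definition w where "w x = (M / f x) powr (1/8)"

lemma w_ge_1: "f x > 0 \<Longrightarrow> 1 \<le> w x"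
  unfolding w_def using f_le_M[of x] by (intro ge_one_powr_ge_zero) auto

lemma w_power4:
  assumes "f x > 0"
  shows "w x ^ 4 * f x = sqrt (M * f x)"
proof -
  have "w x ^ 4 = sqrt (M / f x)"
  proof -
    have "w x ^ 4 = w x powr 4"
      using assms M_pos by (simp add: w_def powr_numeral)
    also have "\<dots> = (M / f x) powr (1 / 2)"
      unfolding w_def powr_powr by simp
    also have "\<dots> = sqrt (M / f x)"
      using assms M_pos by (simp add: powr_half_sqrt)
    finally show ?thesis .
  qed
  moreover have "sqrt (M / f x) * f x = sqrt (M / f x * (f x)\<^sup>2)"
    by (simp only: real_sqrt_mult real_sqrt_pow2_iff real_sqrt_abs abs_of_nonneg[OF nonneg])
  moreover have "M / f x * (f x)\<^sup>2 = M * f x"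
    using assms by (simp add: power2_eq_square)
  ultimately show ?thesis
    by simp
qed

text \<open>Here ln (M / f x) = 8 ln (w x) \<le> 8 (w x - 1), and the slack 8 absorbs the summand 2
  of \<open>inner_le_ln\<close>.\<close>

lemma inner_le_w:
  assumes \<theta>: "norm \<theta> = 1" and fx: "f x > 0"
  shows "\<bar>x \<bullet> \<theta>\<bar> \<le> 8 * decay_const DIM('a) * \<sigma> * w x"
proof -
  have w: "w x > 0"
    using w_ge_1[OF fx] by simp
  have "ln (M / f x) = 8 * ln (w x)"
    using fx M_pos by (simp add: w_def ln_powr)
  also have "\<dots> \<le> 8 * (w x - 1)"
    using ln_le_minus_one[OF w] by simp
  finally have "2 + ln (M / f x) \<le> 8 * w x"
    by simp
  then have "decay_const DIM('a) * \<sigma> * (2 + ln (M / f x)) \<le> decay_const DIM('a) * \<sigma> * (8 * w x)"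
    using \<sigma>_pos decay_const_ge_2[of "DIM('a)"] by (intro mult_left_mono) auto
  then show ?thesis
    using inner_le_ln[OF assms] by (simp add: mult_ac)
qed

section \<open>Lower bounds for first absolute moments\<close>

lemma integrable_abs_inner: "integrable lebesgue (\<lambda>x. \<bar>x \<bullet> \<theta>\<bar> * f x)"
proof -
  have "integrable lebesgue (\<lambda>x. \<bar>(x \<bullet> \<theta>) * f x\<bar>)"
    using mean by (intro integrable_abs) (auto simp: has_bochner_integral_iff)
  then show ?thesis
    using nonneg by (simp add: abs_mult)
qed

text \<open>The variance is interpolated between the first and the fourth moment. The latter is at
  most D^4 \<sigma>^4 2^d, because \<open>inner_le_w\<close> bounds |x \<bullet> \<theta>|^4 f by a
  multiple of w^4 f = sqrt (M f); a small first moment would therefore leave too little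
  variance.\<close>

lemma abs_moment_ge:
  assumes \<theta>: "norm \<theta> = 1"
  shows "\<sigma> / (2 * abs_moment_const DIM('a)) \<le> (LINT x|lebesgue. \<bar>x \<bullet> \<theta>\<bar> * f x)"
proof -
  define a where "a = abs_moment_const DIM('a)"
  define D where "D = 8 * decay_const DIM('a)"
  have a: "0 < a"
    using abs_moment_const_ge_1[of "DIM('a)"] by (simp add: a_def)
  have a2: "a\<^sup>2 = 2 * 2 ^ DIM('a) * D ^ 4"
    by (simp add: a_def D_def abs_moment_const_def power_mult_distrib flip: power_mult)
  have D: "0 < D"
    using decay_const_ge_2[of "DIM('a)"] by (simp add: D_def)
  let ?k = "D ^ 4 * \<sigma>\<^sup>2 / a\<^sup>2"
  have pointwise: "(x \<bullet> \<theta>)\<^sup>2 * f x \<le> a * \<sigma> * (\<bar>x \<bullet> \<theta>\<bar> * f x) + ?k * sqrt (M * f x)" for x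
  proof (cases "f x > 0")
    case True
    define Y where "Y = \<bar>x \<bullet> \<theta>\<bar>"
    have Y0: "0 \<le> Y"
      by (simp add: Y_def)
    have "Y ^ 4 \<le> (D * \<sigma> * w x) ^ 4"
      using inner_le_w[OF \<theta> True] by (intro power_mono) (auto simp: Y_def D_def)
    then have "Y ^ 4 * f x \<le> (D * \<sigma> * w x) ^ 4 * f x"
      by (intro mult_right_mono nonneg)
    also have "\<dots> = D ^ 4 * \<sigma> ^ 4 * (w x ^ 4 * f x)"
      by (simp add: power_mult_distrib)
    also have "\<dots> = D ^ 4 * \<sigma> ^ 4 * sqrt (M * f x)"
      by (simp only: w_power4[OF True])
    finally have Y4: "Y ^ 4 * f x \<le> D ^ 4 * \<sigma> ^ 4 * sqrt (M * f x)" .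
    have "Y\<^sup>2 * f x \<le> a * \<sigma> * (Y * f x) + Y ^ 4 * f x / (a * \<sigma>)\<^sup>2"
    \<comment> \<open>Truncation at a \<sigma>: below it one factor Y is traded for a \<sigma>,
      above it Y^2 is at most Y^4 / (a \<sigma>)^2.\<close>
    proof (cases "Y \<le> a * \<sigma>")
      case True
      have "Y * (Y * f x) \<le> a * \<sigma> * (Y * f x)"
        using True Y0 nonneg by (intro mult_right_mono) auto
      moreover have "0 \<le> Y ^ 4 * f x / (a * \<sigma>)\<^sup>2"
        using nonneg by simp
      ultimately show ?thesis
        by (simp add: power2_eq_square)
    next
      case False
      then have "(a * \<sigma>)\<^sup>2 \<le> Y\<^sup>2"
        using a \<sigma>_pos by (intro power_mono) auto
      then have "(a * \<sigma>)\<^sup>2 * (Y\<^sup>2 * f x) \<le> Y\<^sup>2 * (Y\<^sup>2 * f x)"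
        using nonneg by (intro mult_right_mono) auto
      then have "Y\<^sup>2 * f x \<le> Y ^ 4 * f x / (a * \<sigma>)\<^sup>2"
        using a \<sigma>_pos by (simp add: field_simps flip: power_add)
      moreover have "0 \<le> a * \<sigma> * (Y * f x)"
        using a \<sigma>_pos Y0 nonneg by simp
      ultimately show ?thesis
        by linarith
    qed
    also have "Y ^ 4 * f x / (a * \<sigma>)\<^sup>2 \<le> D ^ 4 * \<sigma> ^ 4 * sqrt (M * f x) / (a * \<sigma>)\<^sup>2"
      by (intro divide_right_mono Y4) auto
    also have "\<dots> = ?k * sqrt (M * f x)"
      using a \<sigma>_pos by (simp add: field_simps power2_eq_square power4_eq_xxxx)
    finally show ?thesis
      by (simp add: Y_def)
  qed (use nonneg[of x] in \<open>auto simp: order_le_less\<close>)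
  have "\<sigma>\<^sup>2 = (LINT x|lebesgue. (x \<bullet> \<theta>)\<^sup>2 * f x)"
    using variance[OF \<theta>] by (simp add: has_bochner_integral_iff)
  also have "\<dots> \<le> (LINT x|lebesgue. a * \<sigma> * (\<bar>x \<bullet> \<theta>\<bar> * f x) + ?k * sqrt (M * f x))"
    using variance[OF \<theta>] pointwise integrable_sqrt_M integrable_abs_inner
    by (intro integral_mono Bochner_Integration.integrable_add integrable_mult_right)
      (auto simp: has_bochner_integral_iff)
  also have "\<dots> = a * \<sigma> * (LINT x|lebesgue. \<bar>x \<bullet> \<theta>\<bar> * f x) + ?k * (LINT x|lebesgue. sqrt (M * f x))"
    using integrable_sqrt_M integrable_abs_inner by simp
  also have "\<dots> \<le> a * \<sigma> * (LINT x|lebesgue. \<bar>x \<bullet> \<theta>\<bar> * f x) + ?k * 2 ^ DIM('a)"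
    by (intro add_left_mono mult_left_mono integral_sqrt_le) auto
  also have "?k * 2 ^ DIM('a) = \<sigma>\<^sup>2 / 2"
    using D by (simp add: a2)
  finally have "\<sigma> * \<sigma> \<le> \<sigma> * (2 * a * (LINT x|lebesgue. \<bar>x \<bullet> \<theta>\<bar> * f x))"
    by (simp add: power2_eq_square algebra_simps)
  then have "\<sigma> \<le> 2 * a * (LINT x|lebesgue. \<bar>x \<bullet> \<theta>\<bar> * f x)"
    using \<sigma>_pos by simp
  then show ?thesis
    using a by (simp add: a_def field_simps)
qed

text \<open>Centering splits the absolute moment evenly: max 0 t is half of |t| + t, and the linear
  term integrates to 0.\<close>

lemma
  assumes \<theta>: "norm \<theta> = 1"
  shows integrable_pos_part: "integrable lebesgue (\<lambda>x. max 0 (x \<bullet> \<theta>) * f x)"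
    and pos_part_moment_ge:
      "\<sigma> / (4 * abs_moment_const DIM('a)) \<le> (LINT x|lebesgue. max 0 (x \<bullet> \<theta>) * f x)"
proof -
  have m: "integrable lebesgue (\<lambda>x. (x \<bullet> \<theta>) * f x)" "(LINT x|lebesgue. (x \<bullet> \<theta>) * f x) = 0"
    using mean by (auto simp: has_bochner_integral_iff)
  have eq: "max 0 (x \<bullet> \<theta>) * f x = (1/2) * (\<bar>x \<bullet> \<theta>\<bar> * f x) + (1/2) * ((x \<bullet> \<theta>) * f x)" for x
    by (auto simp: max_def abs_if)
  show "integrable lebesgue (\<lambda>x. max 0 (x \<bullet> \<theta>) * f x)"
    unfolding eq using m integrable_abs_inner by simp
  have "(LINT x|lebesgue. max 0 (x \<bullet> \<theta>) * f x) = (1/2) * (LINT x|lebesgue. \<bar>x \<bullet> \<theta>\<bar> * f x)"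
    unfolding eq using m integrable_abs_inner[of \<theta>] by simp
  then show "\<sigma> / (4 * abs_moment_const DIM('a)) \<le> (LINT x|lebesgue. max 0 (x \<bullet> \<theta>) * f x)"
    using abs_moment_ge[OF \<theta>] by simp
qed

section \<open>Superlevel sets and the size of \<open>M\<close>\<close>

lemma convex_superlevel: "convex {x. t \<le> f x}"
proof (rule convexI)
  fix x y and u v :: real
  assume xy: "x \<in> {x. t \<le> f x}" "y \<in> {x. t \<le> f x}" and uv: "0 \<le> u" "0 \<le> v" "u + v = 1"
  then have "min (f x) (f y) \<le> f ((1 - v) *\<^sub>R x + v *\<^sub>R y)"
    by (intro quasi_concaveD[where f = f] powr_concave_imp_quasi_concave powr_concave) auto
  moreover have "u = 1 - v"
    using uv by simp
  ultimately show "u *\<^sub>R x + v *\<^sub>R y \<in> {x. t \<le> f x}"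
    using xy by auto
qed

(* If z were outside the superlevel set, a separating hyperplane would leave almost all the
   mass in {x \<bullet> \<theta> \<le> r \<sigma>}, contradicting pos_part_moment_ge. *)
lemma superlevel_contains_ball:
  assumes z: "norm z < inradius_const DIM('a) * \<sigma>"
  shows "inner_level_const DIM('a) ^ 8 * M \<le> f z"
proof (rule ccontr)
  define \<epsilon> where "\<epsilon> = inner_level_const DIM('a)"
  define a where "a = abs_moment_const DIM('a)"
  define D where "D = 8 * decay_const DIM('a)"
  have \<epsilon>: "0 < \<epsilon>" "\<epsilon> < 1"
    using inner_level_const_bounds by (auto simp: \<epsilon>_def)
  have a: "1 \<le> a"
    using abs_moment_const_ge_1 by (simp add: a_def)
  have D: "0 < D"
    using decay_const_ge_2[of "DIM('a)"] by (simp add: D_def)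
  let ?L = "{x. \<epsilon> ^ 8 * M \<le> f x}"
  assume "\<not> inner_level_const DIM('a) ^ 8 * M \<le> f z"
  then have zL: "z \<notin> ?L"
    by (simp add: \<epsilon>_def)
  \<comment> \<open>The supremum need not be attained, so the superlevel set is seen to be nonempty
    from its level lying strictly below \<open>M\<close>.\<close>
  have "\<epsilon> ^ 8 < 1"
    using \<epsilon> by (intro power_less_one_iff[THEN iffD2]) auto
  then have "\<epsilon> ^ 8 * M < M"
    using M_pos by simp
  then obtain y where "\<epsilon> ^ 8 * M < f y"
    unfolding M_def using less_cSUP_iff[OF _ bdd_above_f] by blast
  then have "y \<in> ?L"
    by simp
  then have "?L \<noteq> {}"
    by blast
  then obtain v b where v: "v \<noteq> 0" and sep: "\<forall>x\<in>{z}. v \<bullet> x \<le> b" "\<forall>x\<in>?L. b \<le> v \<bullet> x"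
    using separating_hyperplane_sets[of "{z}" ?L] convex_superlevel zL by (auto simp: disjoint_iff)
  \<comment> \<open>The unit normal pointing away from the superlevel set, on which x \<bullet>
    \<theta> is therefore at most z \<bullet> \<theta> \<le> |z|.\<close>
  define \<theta> where "\<theta> = - (v /\<^sub>R norm v)"
  have \<theta>: "norm \<theta> = 1"
    using v by (simp add: \<theta>_def)
  define r where "r = inradius_const DIM('a)"
  have le: "x \<bullet> \<theta> \<le> r * \<sigma>" if "x \<in> ?L" for x
  proof -
    have "v \<bullet> z \<le> v \<bullet> x"
      using sep that by force
    then have "x \<bullet> \<theta> \<le> z \<bullet> \<theta>"
      using v by (simp add: \<theta>_def inner_commute divide_right_mono)
    also have "\<dots> \<le> norm z"
      using norm_cauchy_schwarz[of z \<theta>] \<theta> by simp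
    finally show ?thesis
      using z by (simp add: r_def)
  qed
  have r: "0 < r"
    using inradius_const_pos by (simp add: r_def)
  have pointwise: "max 0 (x \<bullet> \<theta>) * f x \<le> r * \<sigma> * f x + D * \<sigma> * \<epsilon> * sqrt (M * f x)" for x
  proof (cases "x \<in> ?L")
    case True
    then have "max 0 (x \<bullet> \<theta>) * f x \<le> r * \<sigma> * f x"
      using le r \<sigma>_pos by (intro mult_right_mono nonneg) auto
    moreover have "0 \<le> D * \<sigma> * \<epsilon> * sqrt (M * f x)"
      using D \<sigma>_pos \<epsilon> M_pos nonneg by simp
    ultimately show ?thesis
      by linarith
  next
    case False
    show ?thesis
    proof (cases "f x > 0")
      case True
      have w: "1 \<le> w x"
        by (rule w_ge_1[OF True])
      have "(1 / \<epsilon>) ^ 8 \<le> M / f x"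
        using False True \<epsilon> by (simp add: field_simps)
      then have "((1 / \<epsilon>) ^ 8) powr (1/8) \<le> w x"
        unfolding w_def using \<epsilon> by (intro powr_mono2) auto
      moreover have "((1 / \<epsilon>) ^ 8) powr (1/8) = 1 / \<epsilon>"
      proof -
        have "(1 / \<epsilon>) ^ 8 = (1 / \<epsilon>) powr 8"
          using \<epsilon> by (simp add: powr_numeral)
        then have "((1 / \<epsilon>) ^ 8) powr (1/8) = (1 / \<epsilon>) powr (8 * (1/8))"
          by (simp only: powr_powr)
        then show ?thesis
          using \<epsilon> by simp
      qed
      ultimately have "1 / \<epsilon> \<le> w x"
        by simp
      \<comment> \<open>The eighth power in the level matches the exponent 1/8 in \<open>w\<close>.
        It makes w large outside the superlevel set, and the spare powers in w \<le> \<epsilon> w^4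
        gain the factor \<epsilon>.\<close>
      then have "1 \<le> \<epsilon> * w x"
        using \<epsilon> by (simp add: field_simps)
      then have "1 * w x \<le> \<epsilon> * w x * w x"
        using w by (intro mult_right_mono) auto
      also have "\<dots> = \<epsilon> * w x ^ 2"
        by (simp add: power2_eq_square)
      also have "\<dots> \<le> \<epsilon> * w x ^ 4"
        using w \<epsilon> by (intro mult_left_mono power_increasing) auto
      finally have "w x * f x \<le> \<epsilon> * w x ^ 4 * f x"
        by (intro mult_right_mono nonneg) auto
      then have wf: "w x * f x \<le> \<epsilon> * sqrt (M * f x)"
        by (simp only: mult.assoc w_power4[OF True])
      have "max 0 (x \<bullet> \<theta>) * f x \<le> (D * \<sigma> * w x) * f x"
        using order_trans[OF abs_ge_zero inner_le_w[OF \<theta> True]] inner_le_w[OF \<theta> True]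
        by (intro mult_right_mono nonneg) (auto simp only: D_def max.bounded_iff abs_le_iff)
      also have "\<dots> = D * \<sigma> * (w x * f x)"
        by simp
      also have "\<dots> \<le> D * \<sigma> * (\<epsilon> * sqrt (M * f x))"
        using D \<sigma>_pos by (intro mult_left_mono wf) auto
      finally have "max 0 (x \<bullet> \<theta>) * f x \<le> D * \<sigma> * (\<epsilon> * sqrt (M * f x))" .
      moreover have "0 \<le> r * \<sigma> * f x"
        using r \<sigma>_pos nonneg by simp
      ultimately show ?thesis
        by (simp add: mult.assoc)
    qed (use nonneg[of x] in \<open>auto simp: order_le_less\<close>)
  qed
  have "\<sigma> / (4 * a) \<le> (LINT x|lebesgue. max 0 (x \<bullet> \<theta>) * f x)"
    unfolding a_def by (rule pos_part_moment_ge[OF \<theta>])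
  also have "\<dots> \<le> (LINT x|lebesgue. r * \<sigma> * f x + D * \<sigma> * \<epsilon> * sqrt (M * f x))"
    using integrable_f integrable_sqrt_M
    by (intro integral_mono integrable_pos_part \<theta> pointwise) auto
  also have "\<dots> = r * \<sigma> + D * \<sigma> * \<epsilon> * (LINT x|lebesgue. sqrt (M * f x))"
    using integrable_f integrable_sqrt_M total by (simp add: has_bochner_integral_iff)
  also have "\<dots> \<le> r * \<sigma> + D * \<sigma> * \<epsilon> * 2 ^ DIM('a)"
    using D \<sigma>_pos \<epsilon> by (intro add_left_mono mult_left_mono integral_sqrt_le) auto
  also have "D * \<sigma> * \<epsilon> * 2 ^ DIM('a) = \<sigma> / (16 * a)"
    using D by (simp add: \<epsilon>_def inner_level_const_def a_def D_def)
  also have "r * \<sigma> = \<sigma> / (16 * a)"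
    by (simp add: r_def inradius_const_def a_def)
  finally show False
    using a \<sigma>_pos by (simp add: field_simps)
qed

text \<open>The ball of radius r \<sigma> carries density at least \<epsilon>^8 M, while its mass
  cannot exceed 1.\<close>

lemma M_le:
  "M \<le> 1 / (inner_level_const DIM('a) ^ 8 * inradius_const DIM('a) ^ DIM('a) * measure lborel (ball (0::'a) 1)) / \<sigma> ^ DIM('a)"
proof -
  define \<epsilon> where "\<epsilon> = inner_level_const DIM('a)"
  define r where "r = inradius_const DIM('a)"
  have \<epsilon>: "0 < \<epsilon>" and r: "0 < r"
    using inner_level_const_bounds inradius_const_pos by (auto simp: \<epsilon>_def r_def)
  let ?B = "ball 0 (r * \<sigma>) :: 'a set"
  let ?m = "\<epsilon> ^ 8 * M"
  have B: "has_bochner_integral lebesgue (\<lambda>x. indicator ?B x * ?m) (measure lebesgue ?B * ?m)"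
    by (intro has_bochner_integral_mult_left has_bochner_integral_real_indicator)
      (simp_all add: emeasure_bounded_finite[OF bounded_ball, simplified])
  have "measure lebesgue ?B * ?m \<le> 1"
  proof -
    have "(LINT x|lebesgue. indicator ?B x * ?m) \<le> (LINT x|lebesgue. f x)"
    proof (intro integral_mono integrable_f)
      show "integrable lebesgue (\<lambda>x. indicator ?B x * ?m)"
        using B by (simp add: has_bochner_integral_iff)
      show "indicator ?B x * ?m \<le> f x" for x
        using superlevel_contains_ball[of x] nonneg[of x]
        by (auto simp: indicator_def \<epsilon>_def r_def)
    qed
    then show ?thesis
      using B total by (simp add: has_bochner_integral_iff)
  qed
  also have "measure lebesgue ?B = (r * \<sigma>) ^ DIM('a) * measure lborel (ball (0::'a) 1)"
    using content_ball_conv_unit_ball[of "r * \<sigma>" "0 :: 'a"] r \<sigma>_pos by simp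
  finally have "M * (\<epsilon> ^ 8 * r ^ DIM('a) * measure lborel (ball (0::'a) 1) * \<sigma> ^ DIM('a)) \<le> 1"
    by (simp add: power_mult_distrib mult_ac)
  moreover have "0 < measure lborel (ball (0::'a) 1)"
    by (rule content_ball_pos) simp
  ultimately show ?thesis
    using \<epsilon> r \<sigma>_pos unfolding \<epsilon>_def[symmetric] r_def[symmetric]
    by (simp add: pos_le_divide_eq mult_ac)
qed

text \<open>Summing \<open>inner_le_ln\<close> over the coordinate directions and solving for f. The
  l^1 norm is kept because its exponential factors over the coordinates when lattice sums are
  taken.\<close>

lemma exponential_decay:
  "f x \<le> exp 2 * M * exp (- (\<Sum>b\<in>Basis. \<bar>x \<bullet> b\<bar>) / (DIM('a) * decay_const DIM('a) * \<sigma>))"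
proof (cases "f x > 0")
  case True
  define C where "C = decay_const DIM('a)"
  have C: "0 < C"
    using decay_const_ge_2[of "DIM('a)"] by (simp add: C_def)
  have "(\<Sum>b\<in>Basis. \<bar>x \<bullet> b\<bar>) \<le> (\<Sum>b\<in>(Basis :: 'a set). C * \<sigma> * (2 + ln (M / f x)))"
    unfolding C_def by (intro sum_mono inner_le_ln True) auto
  then have "(\<Sum>b\<in>Basis. \<bar>x \<bullet> b\<bar>) \<le> (DIM('a) * C * \<sigma>) * (2 + ln (M / f x))"
    by (simp add: mult.assoc)
  then have "(\<Sum>b\<in>Basis. \<bar>x \<bullet> b\<bar>) / (DIM('a) * C * \<sigma>) \<le> 2 + ln (M / f x)"
    using C \<sigma>_pos by (simp add: pos_divide_le_eq mult_ac)
  then have "ln (f x) \<le> 2 + ln M - (\<Sum>b\<in>Basis. \<bar>x \<bullet> b\<bar>) / (DIM('a) * C * \<sigma>)"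
    using True M_pos by (simp add: ln_div)
  then have "exp (ln (f x)) \<le> exp (2 + ln M + - (\<Sum>b\<in>Basis. \<bar>x \<bullet> b\<bar>) / (DIM('a) * C * \<sigma>))"
    by simp
  then show ?thesis
    using True M_pos unfolding exp_add C_def by simp
next
  case False
  moreover have "0 \<le> exp 2 * M * exp (- (\<Sum>b\<in>Basis. \<bar>x \<bullet> b\<bar>) / (DIM('a) * decay_const DIM('a) * \<sigma>))"
    using M_pos by simp
  ultimately show ?thesis
    by linarith
qed

end

text \<open>The order of the quantifiers is the point: B and \<alpha> are fixed by the space alone,
  before f and \<sigma>.\<close>

lemma isotropic_density_bound:
  "\<exists>B>0. \<exists>\<alpha>>0. \<forall>(f :: 'a::euclidean_space \<Rightarrow> real) \<sigma> x. isotropic_density f \<sigma> \<longrightarrow>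
     f x \<le> B / \<sigma> ^ DIM('a) * exp (- (\<alpha> / \<sigma> * (\<Sum>b\<in>Basis. \<bar>x \<bullet> b\<bar>)))"
proof -
  define B where "B = exp 2 * (1 / (inner_level_const DIM('a) ^ 8 * inradius_const DIM('a) ^ DIM('a)
    * measure lborel (ball (0::'a) 1)))"
  define \<alpha> where "\<alpha> = 1 / (DIM('a) * decay_const DIM('a))"
  have "0 < measure lborel (ball (0::'a) 1)"
    by (rule content_ball_pos) simp
  then have B: "0 < B"
    using inner_level_const_bounds[of "DIM('a)"] inradius_const_pos[of "DIM('a)"] by (simp add: B_def)
  have \<alpha>: "0 < \<alpha>"
    using decay_const_ge_2[of "DIM('a)"] by (simp add: \<alpha>_def)
  have "f x \<le> B / \<sigma> ^ DIM('a) * exp (- (\<alpha> / \<sigma> * (\<Sum>b\<in>Basis. \<bar>x \<bullet> b\<bar>)))"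
    if "isotropic_density f \<sigma>" for f :: "'a \<Rightarrow> real" and \<sigma> x
  proof -
    interpret isotropic_density f \<sigma>
      by fact
    have "f x \<le> exp 2 * M * exp (- (\<Sum>b\<in>Basis. \<bar>x \<bullet> b\<bar>) / (DIM('a) * decay_const DIM('a) * \<sigma>))"
      by (rule exponential_decay)
    also have "- (\<Sum>b\<in>Basis. \<bar>x \<bullet> b\<bar>) / (DIM('a) * decay_const DIM('a) * \<sigma>)
        = - (\<alpha> / \<sigma> * (\<Sum>b\<in>Basis. \<bar>x \<bullet> b\<bar>))"
      by (simp add: \<alpha>_def)
    also have "exp 2 * M \<le> B / \<sigma> ^ DIM('a)"
      using mult_left_mono[OF M_le, of "exp 2"] by (simp add: B_def)
    finally show ?thesis
      by simp
  qed
  then show ?thesis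
    using B \<alpha> by blast
qed

section \<open>First moments of exponentially decaying densities\<close>

locale exp_decay_density =
  fixes f :: "'a::euclidean_space \<Rightarrow> real" and \<sigma> B \<alpha> :: real
  assumes powr_concave: "powr_concave f"
    and integrable_inner: "integrable lebesgue (\<lambda>x. (x \<bullet> b) * f x)"
    and meas [measurable]: "f \<in> borel_measurable lebesgue"
    and decay: "f x \<le> B / \<sigma> ^ DIM('a) * exp (- (\<alpha> / \<sigma> * (\<Sum>b\<in>Basis. \<bar>x \<bullet> b\<bar>)))"
    and pos: "1 \<le> \<sigma>" "0 < B" "0 < \<alpha>"

text \<open>The prefactor of the line suprema times the (n - 1)-th power of a one-coordinate lattice
  sum, after the powers of \<sigma> have cancelled.\<close>

definition lattice_const :: "real \<Rightarrow> real \<Rightarrow> nat \<Rightarrow> real" where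
  "lattice_const B \<alpha> n = 2 * B / \<alpha> * (exp (\<alpha> / 2) * (4 * (1 + \<alpha> / 2) / \<alpha>)) ^ (n - 1)"

text \<open>Two geometric series, with 0 counted twice; 1 + \<beta> \<le> exp \<beta> turns 1 / (1 -
  q) into (1 + \<beta>) / \<beta>, the growth in \<sigma> that is wanted for \<beta> of order 1 /
  \<sigma>.\<close>

lemma sum_exp_abs_le:
  fixes \<beta> :: real
  assumes \<beta>: "0 < \<beta>" and J: "finite J" "J \<subseteq> \<int>"
  shows "(\<Sum>m\<in>J. exp (- (\<beta> * \<bar>m\<bar>))) \<le> 2 * (1 + \<beta>) / \<beta>"
proof -
  define q where "q = exp (- \<beta>)"
  have q: "0 < q" "q < 1"
    using \<beta> by (auto simp: q_def)
  have "(1 + \<beta>) * q \<le> 1"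
    using exp_ge_add_one_self[of \<beta>] by (simp add: q_def exp_minus field_simps)
  then have "\<beta> \<le> (1 - q) * (1 + \<beta>)"
    by (simp add: algebra_simps)
  obtain N :: nat where N: "\<And>m. m \<in> J \<Longrightarrow> \<bar>m\<bar> < real N"
  proof -
    obtain N :: nat where "Max ((\<lambda>m. \<bar>m\<bar>) ` J) < real N"
      using reals_Archimedean2 by blast
    then show thesis
      using that[of N] J(1) by (metis Max_ge finite_imageI imageI le_less_trans)
  qed
  let ?P = "real ` {..<N}" and ?M = "(\<lambda>j. - real j) ` {..<N}"
  have "J \<subseteq> ?P \<union> ?M"
  proof
    fix m
    assume m: "m \<in> J"
    then obtain i where i: "m = of_int i"
      using J by (auto elim!: Ints_cases)
    show "m \<in> ?P \<union> ?M"
    proof (cases "0 \<le> i")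
      case True
      then have "m = real (nat i)" "nat i < N"
        using N[OF m] by (auto simp: i)
      then show ?thesis
        by blast
    next
      case False
      then have "m = - real (nat (- i))" "nat (- i) < N"
        using N[OF m] by (auto simp: i)
      then show ?thesis
        by blast
    qed
  qed
  then have "(\<Sum>m\<in>J. exp (- (\<beta> * \<bar>m\<bar>))) \<le> (\<Sum>m\<in>?P \<union> ?M. exp (- (\<beta> * \<bar>m\<bar>)))"
    by (intro sum_mono2) auto
  also have "\<dots> \<le> (\<Sum>m\<in>?P. exp (- (\<beta> * \<bar>m\<bar>))) + (\<Sum>m\<in>?M. exp (- (\<beta> * \<bar>m\<bar>)))"
    by (subst sum_Un) (auto intro!: sum_nonneg)
  also have "\<dots> = 2 * (\<Sum>j<N. q ^ j)"
    by (simp add: sum.reindex inj_on_def q_def mult.commute flip: exp_of_nat_mult)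
  also have "\<dots> \<le> 2 * (1 / (1 - q))"
    using q by (intro mult_left_mono) (auto simp: sum_gp_strict divide_right_mono)
  also have "1 / (1 - q) \<le> (1 + \<beta>) / \<beta>"
    using q \<beta> \<open>\<beta> \<le> (1 - q) * (1 + \<beta>)\<close> by (simp add: field_simps)
  finally show ?thesis
    by simp
qed

text \<open>Points with vanishing b-coordinate are determined by their other coordinates, so F
  embeds in a finite product grid, over which the sum of products factors.\<close>

lemma sum_prod_lattice_le:
  fixes F :: "'a::euclidean_space set" and \<phi> :: "real \<Rightarrow> real"
  assumes F: "finite F" "F \<subseteq> basis_lattice" "\<And>k. k \<in> F \<Longrightarrow> k \<bullet> b = 0" and b: "b \<in> Basis"
    and \<phi>: "\<And>m. 0 \<le> \<phi> m" and K: "\<And>J. finite J \<Longrightarrow> J \<subseteq> \<int> \<Longrightarrow> (\<Sum>m\<in>J. \<phi> m) \<le> K"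
  shows "(\<Sum>k\<in>F. \<Prod>c\<in>Basis - {b}. \<phi> (k \<bullet> c)) \<le> K ^ (DIM('a) - 1)"
proof -
  let ?T = "Basis - {b}"
  define J where "J = (\<Union>c\<in>?T. (\<lambda>k. k \<bullet> c) ` F)"
  have J: "finite J" "J \<subseteq> \<int>"
    using F by (auto simp: J_def basis_lattice_def)
  let ?g = "\<lambda>k. restrict (\<lambda>c. k \<bullet> c) ?T"
  have inj: "inj_on ?g F"
  proof (rule inj_onI)
    fix k l
    assume kl: "k \<in> F" "l \<in> F" "?g k = ?g l"
    have "k \<bullet> c = l \<bullet> c" if "c \<in> Basis" for c
    proof (cases "c = b")
      case False
      have "?g k c = ?g l c"
        by (simp only: kl(3))
      then show ?thesis
        using that False by (simp only: restrict_apply) simp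
    qed (use kl F(3) in auto)
    then show "k = l"
      by (rule euclidean_eqI)
  qed
  have "(\<Sum>k\<in>F. \<Prod>c\<in>?T. \<phi> (k \<bullet> c)) = (\<Sum>p\<in>?g ` F. \<Prod>c\<in>?T. \<phi> (p c))"
    by (simp add: sum.reindex[OF inj])
  also have "\<dots> \<le> (\<Sum>p\<in>Pi\<^sub>E ?T (\<lambda>_. J). \<Prod>c\<in>?T. \<phi> (p c))"
    using J by (intro sum_mono2 finite_PiE prod_nonneg \<phi> image_subsetI restrict_PiE_iff[THEN iffD2])
      (auto simp: J_def)
  also have "\<dots> = (\<Prod>c\<in>?T. \<Sum>m\<in>J. \<phi> m)"
    using J by (subst prod_sum_PiE) auto
  also have "\<dots> \<le> (\<Prod>c\<in>?T. K)"
    using J by (intro prod_mono) (auto intro: K sum_nonneg \<phi>)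
  also have "\<dots> = K ^ (DIM('a) - 1)"
    using b by simp
  finally show ?thesis .
qed

context exp_decay_density
begin

lemma nonneg: "0 \<le> f x"
  by (rule powr_concave_nonneg[OF powr_concave])

text \<open>Half of the exponential decay, at rate \<beta> = \<alpha> / (2 \<sigma>), pays for the
  linear factor through t \<le> exp (\<beta> t) / \<beta>. The other half makes the suprema over
  lines summable.\<close>

lemma lattice_comparison_pos_part:
  assumes i: "i \<in> Basis" and s: "\<bar>s\<bar> = 1"
  shows "lattice_comparison (\<lambda>x. max 0 (s * (x \<bullet> i)) * f x)
    (\<lambda>b x. 2 * B / (\<alpha> * \<sigma> ^ (DIM('a) - 1)) * (\<Prod>c\<in>Basis - {b}. exp (- (\<alpha> / (2 * \<sigma>) * \<bar>x \<bullet> c\<bar>))))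
    (\<lambda>_. lattice_const B \<alpha> DIM('a))"
proof
  define \<beta> where "\<beta> = \<alpha> / (2 * \<sigma>)"
  \<comment> \<open>Here \<sigma> \<ge> 1 keeps exp \<beta> and 1 + \<beta> bounded independently of
    \<sigma>.\<close>
  have \<beta>: "0 < \<beta>" "\<beta> \<le> \<alpha> / 2"
    using pos by (auto simp: \<beta>_def field_simps)
  define P where "P = 2 * B / (\<alpha> * \<sigma> ^ (DIM('a) - 1))"
  have P: "0 < P"
    using pos by (auto simp: P_def)
  have \<sigma>: "\<sigma> ^ DIM('a) = \<sigma> * \<sigma> ^ (DIM('a) - 1)"
    using DIM_positive[where 'a = 'a] by (simp add: power_eq_if)
  show "quasi_concave (\<lambda>x. max 0 (s * (x \<bullet> i)) * f x)"
    by (intro powr_concave_imp_quasi_concave powr_concave_mult powr_concave_pos_part_linear powr_concave)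
      (auto intro!: linearI simp: inner_add_left algebra_simps)
  show "0 \<le> max 0 (s * (x \<bullet> i)) * f x" for x
    using nonneg by simp
  show "integrable lebesgue (\<lambda>x. max 0 (s * (x \<bullet> i)) * f x)"
  proof (rule Bochner_Integration.integrable_bound[OF integrable_inner[of i]])
    show "AE x in lebesgue. norm (max 0 (s * (x \<bullet> i)) * f x) \<le> norm ((x \<bullet> i) * f x)"
      using s nonneg by (intro AE_I2) (auto simp: abs_mult abs_if max_def intro!: mult_right_mono split: if_splits)
    show "(\<lambda>x. max 0 (s * (x \<bullet> i)) * f x) \<in> borel_measurable lebesgue"
      by (intro borel_measurable_times borel_measurable_max meas measurable_completion
          borel_measurable_const; simp)
  qed
  fix b :: 'a
  assume b: "b \<in> Basis"
  show "max 0 (s * ((x + t *\<^sub>R b) \<bullet> i)) * f (x + t *\<^sub>R b)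
      \<le> 2 * B / (\<alpha> * \<sigma> ^ (DIM('a) - 1)) * (\<Prod>c\<in>Basis - {b}. exp (- (\<alpha> / (2 * \<sigma>) * \<bar>x \<bullet> c\<bar>)))" for x t
  proof -
    let ?y = "x + t *\<^sub>R b"
    let ?n = "\<Sum>c\<in>Basis. \<bar>?y \<bullet> c\<bar>"
    have "\<beta> * \<bar>?y \<bullet> i\<bar> \<le> \<beta> * ?n"
      using \<beta> i member_le_sum[of i Basis "\<lambda>c. \<bar>?y \<bullet> c\<bar>"] by (intro mult_left_mono) auto
    also have "\<dots> \<le> exp (\<beta> * ?n)"
      using exp_ge_add_one_self[of "\<beta> * ?n"] by linarith
    finally have le: "\<bar>?y \<bullet> i\<bar> \<le> 1 / \<beta> * exp (\<beta> * ?n)"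
      using \<beta> by (simp add: field_simps)
    have "max 0 (s * (?y \<bullet> i)) \<le> \<bar>?y \<bullet> i\<bar>"
      using s by (auto simp: abs_if split: if_splits)
    then have "max 0 (s * (?y \<bullet> i)) * f ?y
        \<le> (1 / \<beta> * exp (\<beta> * ?n)) * (B / \<sigma> ^ DIM('a) * exp (- (\<alpha> / \<sigma> * ?n)))"
      using le \<beta> by (intro mult_mono decay nonneg) auto
    also have "\<dots> = P * exp (- (\<beta> * ?n))"
    proof -
      have "- (\<beta> * ?n) = \<beta> * ?n + - (\<alpha> / \<sigma> * ?n)"
        using pos by (simp add: \<beta>_def field_simps)
      then have "exp (- (\<beta> * ?n)) = exp (\<beta> * ?n) * exp (- (\<alpha> / \<sigma> * ?n))"
        by (simp only: exp_add)
      moreover have "1 / \<beta> * (B / \<sigma> ^ DIM('a)) = P"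
        using pos by (simp add: \<beta>_def P_def \<sigma> field_simps)
      ultimately show ?thesis
        by (metis (no_types, lifting) mult.assoc mult.left_commute)
    qed
    \<comment> \<open>Moving along b alters only the b-coordinate; dropping its term makes the bound
      independent of t.\<close>
    also have "\<dots> \<le> P * exp (- (\<beta> * (\<Sum>c\<in>Basis - {b}. \<bar>x \<bullet> c\<bar>)))"
    proof -
      have "(\<Sum>c\<in>Basis - {b}. \<bar>x \<bullet> c\<bar>) = (\<Sum>c\<in>Basis - {b}. \<bar>?y \<bullet> c\<bar>)"
        using b by (intro sum.cong) (auto simp: inner_add_left inner_Basis)
      also have "\<dots> \<le> ?n"
        by (intro sum_mono2) auto
      finally show ?thesis
        using \<beta> P by (auto intro!: mult_left_mono)
    qed
    also have "\<dots> = P * (\<Prod>c\<in>Basis - {b}. exp (- (\<beta> * \<bar>x \<bullet> c\<bar>)))"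
      by (simp add: exp_sum[symmetric] sum_distrib_left sum_negf)
    finally show ?thesis
      unfolding P_def \<beta>_def .
  qed
  fix F :: "'a set" and v :: 'a
  assume F: "finite F" "F \<subseteq> basis_lattice" "\<And>k. k \<in> F \<Longrightarrow> k \<bullet> b = 0" and v: "v \<in> cbox 0 One"
  \<comment> \<open>The factor exp \<beta> compensates for the shift v, which changes each
    coordinate by at most 1.\<close>
  let ?\<phi> = "\<lambda>m. exp \<beta> * exp (- (\<beta> * \<bar>m\<bar>))"
  let ?K = "exp (\<alpha> / 2) * (4 * (1 + \<alpha> / 2) / \<alpha> * \<sigma>)"
  have "(\<Sum>k\<in>F. P * (\<Prod>c\<in>Basis - {b}. exp (- (\<beta> * \<bar>(k + v) \<bullet> c\<bar>))))
      \<le> (\<Sum>k\<in>F. P * (\<Prod>c\<in>Basis - {b}. ?\<phi> (k \<bullet> c)))"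
  proof (intro sum_mono mult_left_mono prod_mono conjI)
    fix k c :: 'a
    assume "c \<in> Basis - {b}"
    then have "\<bar>v \<bullet> c\<bar> \<le> 1"
      using v by (auto simp: mem_box)
    then have "\<bar>k \<bullet> c\<bar> \<le> 1 + \<bar>(k + v) \<bullet> c\<bar>"
      unfolding inner_add_left by linarith
    then have "\<beta> * \<bar>k \<bullet> c\<bar> \<le> \<beta> * (1 + \<bar>(k + v) \<bullet> c\<bar>)"
      using \<beta> by (intro mult_left_mono) auto
    then show "exp (- (\<beta> * \<bar>(k + v) \<bullet> c\<bar>)) \<le> ?\<phi> (k \<bullet> c)"
      by (simp add: algebra_simps flip: exp_add)
  qed (use P in auto)
  also have "\<dots> = P * (\<Sum>k\<in>F. \<Prod>c\<in>Basis - {b}. ?\<phi> (k \<bullet> c))"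
    by (simp only: sum_distrib_left)
  also have "\<dots> \<le> P * ?K ^ (DIM('a) - 1)"
  proof (intro mult_left_mono sum_prod_lattice_le F b)
    fix J :: "real set"
    assume J: "finite J" "J \<subseteq> \<int>"
    have "(\<Sum>m\<in>J. ?\<phi> m) = exp \<beta> * (\<Sum>m\<in>J. exp (- (\<beta> * \<bar>m\<bar>)))"
      by (simp only: sum_distrib_left)
    also have "\<dots> \<le> exp (\<alpha> / 2) * (2 * (1 + \<beta>) / \<beta>)"
      using \<beta> by (intro mult_mono sum_exp_abs_le J) (auto intro: sum_nonneg)
    also have "\<dots> \<le> exp (\<alpha> / 2) * (2 * (1 + \<alpha> / 2) / \<beta>)"
      using \<beta> by (intro mult_left_mono divide_right_mono) auto
    also have "2 * (1 + \<alpha> / 2) / \<beta> = 4 * (1 + \<alpha> / 2) / \<alpha> * \<sigma>"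
      using pos by (simp add: \<beta>_def)
    finally show "(\<Sum>m\<in>J. ?\<phi> m) \<le> ?K" .
  qed (use P in auto)
  also have "\<dots> = lattice_const B \<alpha> DIM('a)"
  proof -
    let ?W = "exp (\<alpha> / 2) * (4 * (1 + \<alpha> / 2) / \<alpha>)"
    have "?K ^ (DIM('a) - 1) = ?W ^ (DIM('a) - 1) * \<sigma> ^ (DIM('a) - 1)"
      by (simp only: mult.assoc flip: power_mult_distrib)
    then show ?thesis
      using pos by (simp add: P_def lattice_const_def)
  qed
  finally show "(\<Sum>k\<in>F. 2 * B / (\<alpha> * \<sigma> ^ (DIM('a) - 1))
        * (\<Prod>c\<in>Basis - {b}. exp (- (\<alpha> / (2 * \<sigma>) * \<bar>(k + v) \<bullet> c\<bar>)))) \<le> lattice_const B \<alpha> DIM('a)"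
    unfolding P_def \<beta>_def .
qed

lemma
  assumes i: "i \<in> Basis"
  shows summable_first_moment: "(\<lambda>k. (k \<bullet> i) * f k) summable_on basis_lattice"
    and first_moment_comparison:
      "\<bar>(\<Sum>\<^sub>\<infinity>k\<in>basis_lattice. (k \<bullet> i) * f k) - (LINT x|lebesgue. (x \<bullet> i) * f x)\<bar>
        \<le> 2 * (DIM('a) * lattice_const B \<alpha> DIM('a))"
proof -
  let ?h = "\<lambda>s x. max 0 (s * (x \<bullet> i)) * f x"
  note L = lattice_comparison_pos_part[OF i]
  have sums: "?h s summable_on basis_lattice" if "\<bar>s\<bar> = 1" for s
    by (rule lattice_comparison.summable_on_lattice[OF L[OF that]])
  have ints: "integrable lebesgue (?h s)" if "\<bar>s\<bar> = 1" for s
    by (rule lattice_comparison.integrable[OF L[OF that]])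
  have cmp: "\<bar>(\<Sum>\<^sub>\<infinity>k\<in>basis_lattice. ?h s k) - (LINT x|lebesgue. ?h s x)\<bar>
      \<le> DIM('a) * lattice_const B \<alpha> DIM('a)" if "\<bar>s\<bar> = 1" for s
    using lattice_comparison.lattice_sum_comparison[OF L[OF that]] by simp
  have eq: "(x \<bullet> i) * f x = ?h 1 x + - ?h (-1) x" for x
    by (auto simp: max_def)
  show "(\<lambda>k. (k \<bullet> i) * f k) summable_on basis_lattice"
    unfolding eq by (intro summable_on_add summable_on_uminus[THEN iffD2] sums) auto
  have "(\<Sum>\<^sub>\<infinity>k\<in>basis_lattice. (k \<bullet> i) * f k)
      = (\<Sum>\<^sub>\<infinity>k\<in>basis_lattice. ?h 1 k) + - (\<Sum>\<^sub>\<infinity>k\<in>basis_lattice. ?h (-1) k)"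
    unfolding eq infsum_uminus[symmetric]
    by (intro infsum_add summable_on_uminus[THEN iffD2] sums) auto
  moreover have "(LINT x|lebesgue. (x \<bullet> i) * f x) = (LINT x|lebesgue. ?h 1 x) + - (LINT x|lebesgue. ?h (-1) x)"
    unfolding eq integral_minus[symmetric]
    by (intro Bochner_Integration.integral_add Bochner_Integration.integrable_minus ints) auto
  ultimately show "\<bar>(\<Sum>\<^sub>\<infinity>k\<in>basis_lattice. (k \<bullet> i) * f k) - (LINT x|lebesgue. (x \<bullet> i) * f x)\<bar>
        \<le> 2 * (DIM('a) * lattice_const B \<alpha> DIM('a))"
    using cmp[of 1] cmp[of "-1"] by simp
qed

end

section \<open>Passage from the covariance matrix and conclusion\<close>

lemma lattice_const_nonneg: "0 < B \<Longrightarrow> 0 < \<alpha> \<Longrightarrow> 0 \<le> lattice_const B \<alpha> n"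
  by (simp add: lattice_const_def)

lemma int_lattice_eq: "int_lattice = (basis_lattice :: (real ^ 'n) set)"
  by (auto simp: int_lattice_def basis_lattice_def Basis_vec_def inner_axis)

text \<open>The covariance matrix only records values of integrals. Integrability of each product of
  coordinates is recovered before (x \<bullet> \<theta>)^2 can be expanded into the quadratic form,
  which is |\<theta>|^2 \<sigma>^2.\<close>

lemma isotropic_density_of_covariance:
  fixes f :: "real ^ 'n \<Rightarrow> real"
  assumes f: "log_concave_fun f" "prob_density f" "centered_fun f" "isotropic_with \<sigma> f"
  shows "isotropic_density f \<sigma>"
proof
  have total: "has_bochner_integral lebesgue f 1"
    using f by (simp add: prob_density_def)
  have [measurable]: "f \<in> borel_measurable lebesgue"
    using total by (auto simp: has_bochner_integral_iff)
  have coord [measurable]: "(\<lambda>x :: real ^ 'n. x $ i) \<in> borel_measurable lebesgue" for i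
    by (intro measurable_completion) simp
  have nonneg: "0 \<le> f x" for x
    using f by (simp add: prob_density_def)
  have \<sigma>: "0 < \<sigma>" and cov: "covariance_matrix f = mat (\<sigma>\<^sup>2)"
    using f by (auto simp: isotropic_with_def)
  have cent: "has_bochner_integral lebesgue (\<lambda>x. f x *\<^sub>R x) 0"
    using f by (simp add: centered_fun_def)
  then have mean: "mean_vec f = 0"
    by (simp add: mean_vec_def has_bochner_integral_integral_eq)
  show "powr_concave f" "0 < \<sigma>" "has_bochner_integral lebesgue f 1"
    using f \<sigma> total by (auto intro: powr_concave_log_concave)
  fix \<theta> :: "real ^ 'n"
  show "has_bochner_integral lebesgue (\<lambda>x. (x \<bullet> \<theta>) * f x) 0"
    using has_bochner_integral_inner_left[OF cent, of \<theta>] by (simp add: mult.commute)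
  have int: "(LINT x|lebesgue. x $ i * x $ j * f x) = (if i = j then \<sigma>\<^sup>2 else 0)" for i j
  proof -
    have "covariance_matrix f $ i $ j = (if i = j then \<sigma>\<^sup>2 else 0)"
      by (simp add: cov mat_def)
    then show ?thesis
      by (simp add: covariance_matrix_def mean)
  qed
  (* A non-integrable function would have integral 0 by convention. *)
  have sq: "integrable lebesgue (\<lambda>x. x $ i * x $ i * f x)" for i
    using int[of i i] \<sigma> not_integrable_integral_eq[of lebesgue "\<lambda>x. x $ i * x $ i * f x"] by fastforce
  \<comment> \<open>An off-diagonal entry 0 says nothing about integrability, so mixed products are
    dominated by the squares.\<close>
  have prod: "integrable lebesgue (\<lambda>x. x $ i * x $ j * f x)" for i j
  proof (rule Bochner_Integration.integrable_bound)
    show "integrable lebesgue (\<lambda>x. x $ i * x $ i * f x + x $ j * x $ j * f x)"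
      by (intro Bochner_Integration.integrable_add sq)
    show "AE x in lebesgue. norm (x $ i * x $ j * f x) \<le> norm (x $ i * x $ i * f x + x $ j * x $ j * f x)"
    proof (rule AE_I2)
      fix x :: "real ^ 'n"
      have "\<bar>a * b\<bar> \<le> a * a + b * b" for a b :: real
      proof -
        have "(\<bar>a\<bar> - \<bar>b\<bar>)\<^sup>2 = a * a + b * b - 2 * (\<bar>a\<bar> * \<bar>b\<bar>)"
          by (simp add: power2_diff) (simp add: power2_eq_square)
        moreover have "0 \<le> (\<bar>a\<bar> - \<bar>b\<bar>)\<^sup>2"
          by simp
        moreover have "0 \<le> \<bar>a\<bar> * \<bar>b\<bar>"
          by simp
        ultimately show ?thesis
          unfolding abs_mult by linarith
      qed
      then have "\<bar>x $ i * x $ j\<bar> * f x \<le> (x $ i * x $ i + x $ j * x $ j) * f x"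
        by (intro mult_right_mono nonneg)
      then show "norm (x $ i * x $ j * f x) \<le> norm (x $ i * x $ i * f x + x $ j * x $ j * f x)"
        using nonneg[of x] by (simp add: abs_mult distrib_right)
    qed
  qed measurable
  assume \<theta>: "norm \<theta> = 1"
  have "(\<lambda>x. (x \<bullet> \<theta>)\<^sup>2 * f x) = (\<lambda>x. \<Sum>i\<in>UNIV. \<Sum>j\<in>UNIV. \<theta> $ i * \<theta> $ j * (x $ i * x $ j * f x))"
    unfolding inner_vec_def inner_real_def power2_eq_square sum_product
    unfolding sum_distrib_right
    by (intro ext sum.cong refl) (simp only: mult_ac)
  moreover have "has_bochner_integral lebesgue
      (\<lambda>x. \<Sum>i\<in>UNIV. \<Sum>j\<in>UNIV. \<theta> $ i * \<theta> $ j * (x $ i * x $ j * f x))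
      (\<Sum>i\<in>UNIV. \<Sum>j\<in>UNIV. \<theta> $ i * \<theta> $ j * (if i = j then \<sigma>\<^sup>2 else 0))"
    using prod int
    by (intro has_bochner_integral_sum has_bochner_integral_mult_right) (auto simp: has_bochner_integral_iff)
  moreover have "(\<Sum>i\<in>UNIV. \<Sum>j\<in>UNIV. \<theta> $ i * \<theta> $ j * (if i = j then \<sigma>\<^sup>2 else 0)) = \<sigma>\<^sup>2"
  proof -
    have "(\<Sum>i\<in>UNIV. \<Sum>j\<in>UNIV. \<theta> $ i * \<theta> $ j * (if i = j then \<sigma>\<^sup>2 else 0)) = (\<theta> \<bullet> \<theta>) * \<sigma>\<^sup>2"
      by (simp add: inner_vec_def sum_distrib_right if_distrib[of "\<lambda>z. _ * z"] cong: if_cong)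
    then show ?thesis
      using \<theta> by (simp add: dot_square_norm)
  qed
  ultimately show "has_bochner_integral lebesgue (\<lambda>x. (x \<bullet> \<theta>)\<^sup>2 * f x) (\<sigma>\<^sup>2)"
    by simp
qed

theorem proposition29:
  shows "(\<exists>C>0. \<exists>N>0. \<forall>(f :: real ^ 'n \<Rightarrow> real) \<sigma>.
            log_concave_fun f \<and> prob_density f \<and> centered_fun f \<and>
            isotropic_with \<sigma> f \<and> \<sigma> \<ge> N \<longrightarrow>
            (\<forall>i. (\<lambda>k. k $ i * f k) summable_on int_lattice \<and>
                 \<bar>(\<Sum>\<^sub>\<infinity>k\<in>int_lattice. k $ i * f k) - (LINT x|lebesgue. x $ i * f x)\<bar>
                   = \<bar>\<Sum>\<^sub>\<infinity>k\<in>int_lattice. k $ i * f k\<bar> \<and>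
                 \<bar>\<Sum>\<^sub>\<infinity>k\<in>int_lattice. k $ i * f k\<bar> \<le> (C :: real)))
       \<and>
         (\<forall>g :: real \<Rightarrow> real.
            log_concave_fun g \<and> integrable lebesgue g \<and> (LINT x|lebesgue. g x) > 0 \<and>
            centered_fun g \<longrightarrow>
            g summable_on \<int> \<and> (\<lambda>k. k * g k) summable_on \<int> \<and>
            \<bar>(LINT x|lebesgue. x * g x) - (\<Sum>\<^sub>\<infinity>k\<in>\<int>. k * g k)\<bar>
              \<le> (exp 1 + 1) * (\<Sum>\<^sub>\<infinity>k\<in>\<int>. g k))"
proof (intro conjI allI impI)
  obtain B \<alpha> where B: "0 < B" and \<alpha>: "0 < \<alpha>"
    and bound: "\<And>(f :: real ^ 'n \<Rightarrow> real) \<sigma> x. isotropic_density f \<sigma> \<Longrightarrow>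
      f x \<le> B / \<sigma> ^ DIM(real ^ 'n) * exp (- (\<alpha> / \<sigma> * (\<Sum>b\<in>Basis. \<bar>x \<bullet> b\<bar>)))"
    using isotropic_density_bound[where 'a = "real ^ 'n"] by blast
  \<comment> \<open>The summand 1 makes C strictly positive, as \<open>lattice_const\<close> is only
    known to be nonnegative.\<close>
  define C where "C = 2 * (DIM(real ^ 'n) * lattice_const B \<alpha> DIM(real ^ 'n)) + 1"
  have C: "0 < C"
    using lattice_const_nonneg[OF B \<alpha>] by (simp add: C_def add_nonneg_pos)
  have main: "(\<lambda>k. k $ i * f k) summable_on int_lattice \<and>
      \<bar>(\<Sum>\<^sub>\<infinity>k\<in>int_lattice. k $ i * f k) - (LINT x|lebesgue. x $ i * f x)\<bar>
        = \<bar>\<Sum>\<^sub>\<infinity>k\<in>int_lattice. k $ i * f k\<bar> \<and>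
      \<bar>\<Sum>\<^sub>\<infinity>k\<in>int_lattice. k $ i * f k\<bar> \<le> C"
    if f: "log_concave_fun f" "prob_density f" "centered_fun f" "isotropic_with \<sigma> f" and \<sigma>: "1 \<le> \<sigma>"
    for f :: "real ^ 'n \<Rightarrow> real" and \<sigma> i
  proof -
    have iso: "isotropic_density f \<sigma>"
      by (rule isotropic_density_of_covariance[OF f])
    interpret isotropic_density f \<sigma>
      by (rule iso)
    interpret exp_decay_density f \<sigma> B \<alpha>
      using powr_concave mean bound[OF iso] B \<alpha> \<sigma> measurable_f
      by unfold_locales (auto simp: has_bochner_integral_iff)
    have i: "axis i 1 \<in> (Basis :: (real ^ 'n) set)" "x \<bullet> axis i 1 = x $ i" for x :: "real ^ 'n"
      by (auto simp: inner_axis)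
    have "(LINT x|lebesgue. x $ i * f x) = 0"
      using mean[of "axis i 1"] by (simp add: i has_bochner_integral_iff)
    then show ?thesis
      using summable_first_moment[OF i(1)] first_moment_comparison[OF i(1)]
      by (simp add: i int_lattice_eq C_def)
  qed
  show "\<exists>C>0. \<exists>N>0. \<forall>(f :: real ^ 'n \<Rightarrow> real) \<sigma>.
            log_concave_fun f \<and> prob_density f \<and> centered_fun f \<and>
            isotropic_with \<sigma> f \<and> \<sigma> \<ge> N \<longrightarrow>
            (\<forall>i. (\<lambda>k. k $ i * f k) summable_on int_lattice \<and>
                 \<bar>(\<Sum>\<^sub>\<infinity>k\<in>int_lattice. k $ i * f k) - (LINT x|lebesgue. x $ i * f x)\<bar>
                   = \<bar>\<Sum>\<^sub>\<infinity>k\<in>int_lattice. k $ i * f k\<bar> \<and>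
                 \<bar>\<Sum>\<^sub>\<infinity>k\<in>int_lattice. k $ i * f k\<bar> \<le> (C :: real))"
    using main C by (intro exI[of _ C] conjI exI[of _ 1]) auto
next
  fix g :: "real \<Rightarrow> real"
  assume g: "log_concave_fun g \<and> integrable lebesgue g \<and> (LINT x|lebesgue. g x) > 0 \<and> centered_fun g"
  then have "powr_concave g" "integrable lebesgue g" "(LINT x|lebesgue. g x) > 0"
    "has_bochner_integral lebesgue (\<lambda>x. x * g x) 0"
    by (auto intro: powr_concave_log_concave simp: centered_fun_def mult.commute)
  note moment = first_moment_Ints[OF this]
  show "g summable_on \<int>" "(\<lambda>k. k * g k) summable_on \<int>"
    "\<bar>(LINT x|lebesgue. x * g x) - (\<Sum>\<^sub>\<infinity>k\<in>\<int>. k * g k)\<bar> \<le> (exp 1 + 1) * (\<Sum>\<^sub>\<infinity>k\<in>\<int>. g k)"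
    by (rule moment)+
qed

end
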